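(* For every metric space $X$ there exists an isometric closed embedding $X\hookrightarrow Z$ (that is, an isometric embedding with closed image) into a metrically ultrahomogeneous space $Z$ such that $\dim(Z)=\dim(X)$ and $|Z|=|X|$.
   Context: A metric space $Z$ is metrically ultrahomogeneous if every isometry between two finite subspaces of $Z$ extends to a global isometry of $Z$ onto itself. $\dim$ denotes (Lebesgue) covering dimension, and $|\cdot|$ denotes cardinality.
   Formalization: For finite X the equality |Z|=|X| fails in general (e.g. X={0,1,2} on the line, which is not metrically ultrahomogeneous), so for finite X it is replaced by "Z is countable"; for infinite X, |Z|=|X| is proved as stated. *)

theory Defs
  imports "HOL-Analysis.Analysis"
begin

section \<open>Isometries\<close>

definition isometric_embedding :: "'a metric \<Rightarrow> 'b metric \<Rightarrow> ('a \<Rightarrow> 'b) \<Rightarrow> bool" where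
  "isometric_embedding X Y f \<longleftrightarrow>
     f \<in> mspace X \<rightarrow> mspace Y \<and>
     (\<forall>x\<in>mspace X. \<forall>y\<in>mspace X. mdist Y (f x) (f y) = mdist X x y)"

definition closed_isometric_embedding :: "'a metric \<Rightarrow> 'b metric \<Rightarrow> ('a \<Rightarrow> 'b) \<Rightarrow> bool" where
  "closed_isometric_embedding X Y f \<longleftrightarrow>
     isometric_embedding X Y f \<and> closedin (mtopology_of Y) (f ` mspace X)"

definition isometry_onto :: "'a metric \<Rightarrow> 'b metric \<Rightarrow> ('a \<Rightarrow> 'b) \<Rightarrow> bool" where
  "isometry_onto X Y f \<longleftrightarrow> isometric_embedding X Y f \<and> f ` mspace X = mspace Y"

definition metrically_ultrahomogeneous :: "'a metric \<Rightarrow> bool" where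
  "metrically_ultrahomogeneous Z \<longleftrightarrow>
     (\<forall>A B f. A \<subseteq> mspace Z \<and> finite A \<and> B \<subseteq> mspace Z \<and> finite B \<and>
        isometry_onto (submetric Z A) (submetric Z B) f \<longrightarrow>
        (\<exists>g. isometry_onto Z Z g \<and> (\<forall>x\<in>A. g x = f x)))"

section \<open>Covering dimension\<close>

definition finite_open_cover :: "'a topology \<Rightarrow> 'a set set \<Rightarrow> bool" where
  "finite_open_cover T \<U> \<longleftrightarrow> finite \<U> \<and> (\<forall>U\<in>\<U>. openin T U) \<and> \<Union>\<U> = topspace T"

definition refines :: "'a set set \<Rightarrow> 'a set set \<Rightarrow> bool" where
  "refines \<V> \<U> \<longleftrightarrow> (\<forall>V\<in>\<V>. \<exists>U\<in>\<U>. V \<subseteq> U)"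

text \<open>The Cech-Lebesgue definition through finite open covers, as in Engelking. For
  metrizable (indeed, paracompact Hausdorff) spaces the version with arbitrary open covers gives
  the same dimension. Order at most \<open>n\<close> means that every point lies in at most \<open>n + 1\<close> members.\<close>

definition covering_dim_le :: "'a topology \<Rightarrow> nat \<Rightarrow> bool" where
  "covering_dim_le T n \<longleftrightarrow>
     (\<forall>\<U>. finite_open_cover T \<U> \<longrightarrow>
        (\<exists>\<V>. finite_open_cover T \<V> \<and> refines \<V> \<U> \<and>
             (\<forall>x\<in>topspace T. card {V \<in> \<V>. x \<in> V} \<le> n + 1)))"

text \<open>The value is \<open>-1\<close> exactly for the empty space, and \<open>\<infinity>\<close> (the infimum of the empty set)
  if no \<open>n\<close> is an upper bound.\<close>

definition covering_dim :: "'a topology \<Rightarrow> ereal" where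
  "covering_dim T =
     (if topspace T = {} then -1 else Inf {ereal (real n) | n. covering_dim_le T n})"

end

theory Submission
  imports Defs
begin

text \<open>
  Attach to \<open>X\<close>, for every finite partial isometry \<open>f\<close>, a copy of \<open>X\<close> along \<open>f\<close> and give the result
  the amalgam metric, so that \<open>f\<close> extends to an isometric embedding of \<open>X\<close> into the larger space
  \<open>X\<^sub>1\<close>. In \<open>X\<^sub>1\<close> the inverses of these extensions are again isometries between closed sets and are
  extended in the same way, together with the finite partial isometries of \<open>X\<^sub>1\<close>. After \<open>\<omega>\<close> steps
  this back-and-forth extends every finite partial isometry of the union \<open>Z\<close> to an isometry of \<open>Z\<close>
  onto itself.

  The dimension does not grow in one step: \<open>X\<^sub>1\<close> is the union of the closed set \<open>X\<close> and the closed
  sets of points at distance at least \<open>1/k\<close> from \<open>X\<close>, each of which is a discrete sum of closed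
  subsets of copies of \<open>X\<close>; so the countable closed sum theorem applies. It applies once more to
  the union of the closed stages.
\<close>

subsection \<open>Covering dimension\<close>

text \<open>Gluing works only along closed sets. A point off the domain but in its closure would get
  a copy at no positive distance from the old space, so that the old space would not be closed in
  the new one or distinct points would have distance 0. Closedness of the range makes the image of
  the extended isometry closed, so that its converse can be glued in turn. Cardinality forbids
  attaching a copy for every isometry between closed sets. Only finite partial isometries and the
  extensions descending from them are continued; each is named by a finite list of pairs and a
  number of steps, and an infinite space has no more such names than points. An empty relation gets
  no copy, since no path would join the copy to the old space.\<close>

definition open_family :: "'a topology \<Rightarrow> 'i set \<Rightarrow> ('i \<Rightarrow> 'a set) \<Rightarrow> bool" where
  "open_family T I U \<longleftrightarrow> (\<forall>i\<in>I. openin T (U i)) \<and> (\<Union>i\<in>I. U i) = topspace T"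

lemma open_family_subtopology:
  assumes "open_family T I U" "F \<subseteq> topspace T"
  shows "open_family (subtopology T F) I (\<lambda>i. U i \<inter> F)"
  unfolding open_family_def
proof
  show "\<forall>i\<in>I. openin (subtopology T F) (U i \<inter> F)"
    using assms(1) unfolding open_family_def openin_subtopology by blast
  have "(\<Union>i\<in>I. U i \<inter> F) = (\<Union>i\<in>I. U i) \<inter> F"
    by blast
  then show "(\<Union>i\<in>I. U i \<inter> F) = topspace (subtopology T F)"
    using assms(1) unfolding open_family_def by simp
qed

text \<open>Members of a refinement that are assigned to the same index are merged, so the
  refinement keeps the index set of the given cover. A point lies in the merged set at
  \<open>i\<close> only through a member assigned to \<open>i\<close>; hence the order does not
  grow.\<close>

lemma covering_dim_leD:
  assumes "covering_dim_le T n" "finite I" "open_family T I U"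
  shows "\<exists>V. open_family T I V \<and> (\<forall>i\<in>I. V i \<subseteq> U i) \<and> (\<forall>x\<in>topspace T. card {i \<in> I. x \<in> V i} \<le> n + 1)"
proof -
  have "finite_open_cover T (U ` I)"
    using assms(2,3) by (auto simp: finite_open_cover_def open_family_def)
  then obtain \<V> where \<V>: "finite_open_cover T \<V>" "refines \<V> (U ` I)"
    and ord: "\<And>x. x \<in> topspace T \<Longrightarrow> card {V \<in> \<V>. x \<in> V} \<le> n + 1"
    using assms(1) unfolding covering_dim_le_def by meson
  have "\<forall>V\<in>\<V>. \<exists>i. i \<in> I \<and> V \<subseteq> U i"
    using \<V>(2) by (auto simp: refines_def)
  then obtain s where s: "\<And>V. V \<in> \<V> \<Longrightarrow> s V \<in> I \<and> V \<subseteq> U (s V)"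
    by metis
  define W where "W i = \<Union>{V \<in> \<V>. s V = i}" for i
  show ?thesis
  proof (intro exI[of _ W] conjI ballI)
    show "open_family T I W"
      unfolding open_family_def
    proof
      show "\<forall>i\<in>I. openin T (W i)"
        using \<V>(1) by (auto simp: finite_open_cover_def W_def)
      have "(\<Union>i\<in>I. W i) = \<Union>\<V>"
        using s by (auto simp: W_def)
      then show "(\<Union>i\<in>I. W i) = topspace T"
        using \<V>(1) by (simp add: finite_open_cover_def)
    qed
    show "W i \<subseteq> U i" if "i \<in> I" for i
      using s by (auto simp: W_def)
    show "card {i \<in> I. x \<in> W i} \<le> n + 1" if "x \<in> topspace T" for x
    proof -
      have fin: "finite {V \<in> \<V>. x \<in> V}"
        using \<V>(1) by (auto simp: finite_open_cover_def)
      have "{i \<in> I. x \<in> W i} \<subseteq> s ` {V \<in> \<V>. x \<in> V}"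
        by (auto simp: W_def)
      then have "card {i \<in> I. x \<in> W i} \<le> card {V \<in> \<V>. x \<in> V}"
        using fin surj_card_le by blast
      then show ?thesis
        using ord[OF that] by linarith
    qed
  qed
qed

text \<open>A finite cover indexes itself, so index sets of type \<open>'a set set\<close> suffice.
  Passing from a family back to the set of its members may identify members, which only lowers the
  order.\<close>

lemma covering_dim_leI:
  fixes T :: "'a topology"
  assumes "\<And>(I :: 'a set set) U. finite I \<Longrightarrow> open_family T I U \<Longrightarrow>
    \<exists>V. open_family T I V \<and> (\<forall>i\<in>I. V i \<subseteq> U i) \<and> (\<forall>x\<in>topspace T. card {i \<in> I. x \<in> V i} \<le> n + 1)"
  shows "covering_dim_le T n"
  unfolding covering_dim_le_def
proof (intro allI impI)
  fix \<U> :: "'a set set" assume \<U>: "finite_open_cover T \<U>"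
  then have "finite \<U>" "open_family T \<U> (\<lambda>U. U)"
    by (auto simp: finite_open_cover_def open_family_def)
  from assms[OF this] obtain V where V: "open_family T \<U> V" "\<forall>i\<in>\<U>. V i \<subseteq> i"
    and ord: "\<forall>x\<in>topspace T. card {i \<in> \<U>. x \<in> V i} \<le> n + 1"
    by metis
  have "card {W \<in> V ` \<U>. x \<in> W} \<le> n + 1" if "x \<in> topspace T" for x
  proof -
    have "{W \<in> V ` \<U>. x \<in> W} \<subseteq> V ` {i \<in> \<U>. x \<in> V i}"
      by auto
    then have "card {W \<in> V ` \<U>. x \<in> W} \<le> card {i \<in> \<U>. x \<in> V i}"
      using \<open>finite \<U>\<close> by (simp add: surj_card_le)
    then show ?thesis
      using ord that by fastforce
  qed
  then show "\<exists>\<V>. finite_open_cover T \<V> \<and> refines \<V> \<U> \<and>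
      (\<forall>x\<in>topspace T. card {V \<in> \<V>. x \<in> V} \<le> n + 1)"
    using V \<open>finite \<U>\<close>
    by (intro exI[of _ "V ` \<U>"]) (auto simp: finite_open_cover_def open_family_def refines_def)
qed

lemma covering_dim_le_closed_subtopology:
  assumes "covering_dim_le T n" "closedin T F"
  shows "covering_dim_le (subtopology T F) n"
proof (rule covering_dim_leI)
  fix I :: "'a set set" and U
  assume I: "finite I" and U: "open_family (subtopology T F) I U"
  have F: "F \<subseteq> topspace T" "openin T (topspace T - F)"
    using assms(2) by (auto simp: closedin_def)
  then have top: "topspace (subtopology T F) = F"
    by auto
  show "\<exists>V. open_family (subtopology T F) I V \<and> (\<forall>i\<in>I. V i \<subseteq> U i) \<and>
      (\<forall>x\<in>topspace (subtopology T F). card {i \<in> I. x \<in> V i} \<le> n + 1)"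
  \<comment> \<open>The complement of \<open>F\<close> will be added to the members, so there must
    be one to carry it. An empty family covers only the empty space.\<close>
  proof (cases "I = {}")
    case True
    then show ?thesis
      using U by (auto simp: open_family_def)
  next
    case False
    have "\<forall>i\<in>I. \<exists>G. openin T G \<and> U i = G \<inter> F"
      using U by (auto simp: open_family_def openin_subtopology)
    then obtain G where G: "\<And>i. i \<in> I \<Longrightarrow> openin T (G i)" "\<And>i. i \<in> I \<Longrightarrow> U i = G i \<inter> F"
      by metis
    have "F = (\<Union>i\<in>I. U i)"
      using U top by (simp add: open_family_def)
    then have sub: "F \<subseteq> (\<Union>i\<in>I. G i)"
      using G(2) by auto
    have "open_family T I (\<lambda>i. G i \<union> (topspace T - F))"
      unfolding open_family_def
    proof
      show "\<forall>i\<in>I. openin T (G i \<union> (topspace T - F))"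
        using G(1) F by auto
      show "(\<Union>i\<in>I. G i \<union> (topspace T - F)) = topspace T"
        using sub G(1)[THEN openin_subset] False by blast
    qed
    from covering_dim_leD[OF assms(1) I this]
    obtain V where V: "open_family T I V" "\<forall>i\<in>I. V i \<subseteq> G i \<union> (topspace T - F)"
      and ord: "\<forall>x\<in>topspace T. card {i \<in> I. x \<in> V i} \<le> n + 1"
      by blast
    show ?thesis
    proof (intro exI[of _ "\<lambda>i. V i \<inter> F"] conjI ballI)
      show "open_family (subtopology T F) I (\<lambda>i. V i \<inter> F)"
        using V(1) F(1) by (rule open_family_subtopology)
      show "V i \<inter> F \<subseteq> U i" if "i \<in> I" for i
        using V(2) G(2)[OF that] that by auto
      show "card {i \<in> I. x \<in> V i \<inter> F} \<le> n + 1" if "x \<in> topspace (subtopology T F)" for x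
        using ord that by auto
    qed
  qed
qed

lemma homeomorphic_covering_dim_le:
  assumes "S homeomorphic_space T" "covering_dim_le S n"
  shows "covering_dim_le T n"
proof (rule covering_dim_leI)
  fix I :: "'b set set" and U
  assume I: "finite I" and U: "open_family T I U"
  obtain f g where fg: "homeomorphic_maps S T f g"
    using assms(1) by (auto simp: homeomorphic_space_def)
  then have f: "continuous_map S T f" and g: "continuous_map T S g"
    and gf: "\<And>x. x \<in> topspace S \<Longrightarrow> g (f x) = x" and fg': "\<And>y. y \<in> topspace T \<Longrightarrow> f (g y) = y"
    by (auto simp: homeomorphic_maps_def)
  have "open_family S I (\<lambda>i. {x \<in> topspace S. f x \<in> U i})"
    using U f continuous_map_image_subset_topspace[OF f]
    unfolding open_family_def continuous_map by blast
  from covering_dim_leD[OF assms(2) I this]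
  obtain V where V: "open_family S I V" "\<forall>i\<in>I. V i \<subseteq> {x \<in> topspace S. f x \<in> U i}"
    and ord: "\<forall>x\<in>topspace S. card {i \<in> I. x \<in> V i} \<le> n + 1"
    by blast
  have gT: "g y \<in> topspace S" if "y \<in> topspace T" for y
    using continuous_map_image_subset_topspace[OF g] that by auto
  show "\<exists>V. open_family T I V \<and> (\<forall>i\<in>I. V i \<subseteq> U i) \<and>
      (\<forall>x\<in>topspace T. card {i \<in> I. x \<in> V i} \<le> n + 1)"
  proof (intro exI[of _ "\<lambda>i. {y \<in> topspace T. g y \<in> V i}"] conjI ballI)
    show "open_family T I (\<lambda>i. {y \<in> topspace T. g y \<in> V i})"
      using V(1) g gT unfolding open_family_def continuous_map by blast
    show "{y \<in> topspace T. g y \<in> V i} \<subseteq> U i" if "i \<in> I" for i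
      using V(2) that fg' by fastforce
    show "card {i \<in> I. y \<in> {y \<in> topspace T. g y \<in> V i}} \<le> n + 1" if "y \<in> topspace T" for y
      using bspec[OF ord gT[OF that]] that by simp
  qed
qed

text \<open>The pieces are refined independently and the refinements united index by index; a point
  meets only the refinement of its own piece. The number of pieces is arbitrary, as the number of
  glued copies will be.\<close>

lemma covering_dim_le_disjoint_open_Union:
  assumes cov: "(\<Union>c\<in>\<C>. C c) = topspace T"
    and disj: "disjoint_family_on C \<C>"
    and op: "\<And>c. c \<in> \<C> \<Longrightarrow> openin T (C c)"
    and dim: "\<And>c. c \<in> \<C> \<Longrightarrow> covering_dim_le (subtopology T (C c)) n"
  shows "covering_dim_le T n"
proof (rule covering_dim_leI)
  fix I :: "'a set set" and U
  assume I: "finite I" and U: "open_family T I U"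
  have top: "topspace (subtopology T (C c)) = C c" if "c \<in> \<C>" for c
    using cov that by (auto simp: topspace_subtopology)
  have "\<exists>V. open_family (subtopology T (C c)) I V \<and> (\<forall>i\<in>I. V i \<subseteq> U i) \<and>
      (\<forall>x\<in>C c. card {i \<in> I. x \<in> V i} \<le> n + 1)" if c: "c \<in> \<C>" for c
  proof -
    have "open_family (subtopology T (C c)) I (\<lambda>i. U i \<inter> C c)"
      using U by (rule open_family_subtopology) (use cov c in auto)
    from covering_dim_leD[OF dim[OF c] I this] show ?thesis
      unfolding top[OF c] by blast
  qed
  then obtain V where V: "\<And>c. c \<in> \<C> \<Longrightarrow> open_family (subtopology T (C c)) I (V c)"
    "\<And>c i. c \<in> \<C> \<Longrightarrow> i \<in> I \<Longrightarrow> V c i \<subseteq> U i"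
    and ord: "\<And>c x. c \<in> \<C> \<Longrightarrow> x \<in> C c \<Longrightarrow> card {i \<in> I. x \<in> V c i} \<le> n + 1"
    by metis
  have VC: "V c i \<subseteq> C c" and Vop: "openin T (V c i)" if "c \<in> \<C>" "i \<in> I" for c i
    using V(1)[OF that(1)] that top[OF that(1)] op[OF that(1)]
    by (auto simp: open_family_def openin_open_subtopology)
  have Vcov: "(\<Union>i\<in>I. V c i) = C c" if "c \<in> \<C>" for c
    using V(1)[OF that] top[OF that] by (simp add: open_family_def)
  show "\<exists>V. open_family T I V \<and> (\<forall>i\<in>I. V i \<subseteq> U i) \<and>
      (\<forall>x\<in>topspace T. card {i \<in> I. x \<in> V i} \<le> n + 1)"
  proof (intro exI[of _ "\<lambda>i. \<Union>c\<in>\<C>. V c i"] conjI ballI)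
    show "open_family T I (\<lambda>i. \<Union>c\<in>\<C>. V c i)"
      unfolding open_family_def
    proof
      show "\<forall>i\<in>I. openin T (\<Union>c\<in>\<C>. V c i)"
        using Vop by auto
      have "(\<Union>i\<in>I. \<Union>c\<in>\<C>. V c i) = (\<Union>c\<in>\<C>. \<Union>i\<in>I. V c i)"
        by auto
      also have "\<dots> = topspace T"
        using Vcov cov by simp
      finally show "(\<Union>i\<in>I. \<Union>c\<in>\<C>. V c i) = topspace T" .
    qed
    show "(\<Union>c\<in>\<C>. V c i) \<subseteq> U i" if "i \<in> I" for i
      using V(2) that by auto
    show "card {i \<in> I. x \<in> (\<Union>c\<in>\<C>. V c i)} \<le> n + 1" if x: "x \<in> topspace T" for x
    proof -
      obtain c where c: "c \<in> \<C>" "x \<in> C c"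
        using cov x by blast
      have eq: "c' = c" if "c' \<in> \<C>" "i \<in> I" "x \<in> V c' i" for c' i
        using VC[OF that(1,2)] that(3) c disj that(1) unfolding disjoint_family_on_def by blast
      have "{i \<in> I. x \<in> (\<Union>c\<in>\<C>. V c i)} = {i \<in> I. x \<in> V c i}"
        using c(1) eq by blast
      then show ?thesis
        using ord[OF c] by simp
    qed
  qed
qed

section \<open>Shrinking in normal spaces and the countable closed sum theorem\<close>

lemma open_family_shrink_closure:
  assumes "normal_space T" "finite I" "open_family T I U"
  shows "\<exists>V. open_family T I V \<and> (\<forall>i\<in>I. T closure_of (V i) \<subseteq> U i)"
proof -
  \<comment> \<open>\<open>W\<close> is the part of the cover that stays as it is. In the induction
    step the new member is first counted into \<open>W\<close>; afterwards it is shrunk around the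
    closed set that all other sets miss.\<close>
  have "\<exists>V. (\<forall>i\<in>I. openin T (V i) \<and> T closure_of (V i) \<subseteq> U i) \<and> (\<Union>i\<in>I. V i) \<union> W = topspace T"
    if "\<forall>i\<in>I. openin T (U i)" "openin T W" "(\<Union>i\<in>I. U i) \<union> W = topspace T" for W
    using \<open>finite I\<close> that
  proof (induction I arbitrary: W)
    case empty
    then show ?case by auto
  next
    case (insert i I)
    have "\<forall>i\<in>I. openin T (U i)" "openin T (U i \<union> W)" "(\<Union>i\<in>I. U i) \<union> (U i \<union> W) = topspace T"
      using insert.prems by auto
    from insert.IH[OF this] obtain V
      where V: "\<forall>i\<in>I. openin T (V i) \<and> T closure_of (V i) \<subseteq> U i"
        "(\<Union>i\<in>I. V i) \<union> (U i \<union> W) = topspace T"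
      by blast
    define C where "C = topspace T - ((\<Union>i\<in>I. V i) \<union> W)"
    have "openin T ((\<Union>i\<in>I. V i) \<union> W)"
      using V(1) insert.prems by (intro openin_Un openin_Union) auto
    then have "closedin T C"
      unfolding C_def by blast
    moreover have "C \<subseteq> U i" "openin T (U i)"
      using V(2) insert.prems by (auto simp: C_def)
    ultimately obtain G where G: "openin T G" "C \<subseteq> G" "T closure_of G \<subseteq> U i"
      using \<open>normal_space T\<close> unfolding normal_space_alt by meson
    have "G \<subseteq> topspace T" "(\<Union>i\<in>I. V i) \<subseteq> topspace T" "W \<subseteq> topspace T"
      using openin_subset[OF G(1)] V(2) by auto
    then have "G \<union> (\<Union>i\<in>I. V i) \<union> W = topspace T"
      using G(2) unfolding C_def by blast
    then show ?case
      using V(1) G insert.hyps by (intro exI[of _ "V(i := G)"]) auto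
  qed
  from this[of "{}"] obtain V where "\<forall>i\<in>I. openin T (V i) \<and> T closure_of (V i) \<subseteq> U i"
    "(\<Union>i\<in>I. V i) = topspace T"
    using assms(3) unfolding open_family_def by auto
  then show ?thesis
    by (intro exI[of _ V]) (auto simp: open_family_def)
qed

text \<open>For each set of \<open>n + 1\<close> indices the complements of the closed sets cover the space; shrinking
  this cover enlarges the closed sets without creating a common point.\<close>

lemma closed_family_swell:
  assumes "normal_space T" "finite I"
    and B: "\<And>i. i \<in> I \<Longrightarrow> closedin T (B i)" "\<And>i. i \<in> I \<Longrightarrow> B i \<subseteq> U i"
    and U: "\<And>i. i \<in> I \<Longrightarrow> openin T (U i)"
    and ord: "\<And>x. x \<in> topspace T \<Longrightarrow> card {i \<in> I. x \<in> B i} \<le> n"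
  shows "\<exists>V. (\<forall>i\<in>I. openin T (V i) \<and> B i \<subseteq> V i \<and> V i \<subseteq> U i) \<and>
    (\<forall>x\<in>topspace T. card {i \<in> I. x \<in> V i} \<le> n)"
proof -
  define \<S> where "\<S> = {S. S \<subseteq> I \<and> card S = Suc n}"
  have "finite \<S>"
    using \<open>finite I\<close> by (auto simp: \<S>_def)
  have "\<exists>G. (\<forall>i\<in>S. openin T (G i) \<and> B i \<subseteq> G i) \<and> (\<Inter>i\<in>S. G i) = {}" if "S \<in> \<S>" for S
  proof -
    have S: "S \<subseteq> I" "card S = Suc n" "finite S" "S \<noteq> {}"
      using that \<open>finite I\<close> by (auto simp: \<S>_def intro: finite_subset)
    have "open_family T S (\<lambda>i. topspace T - B i)"
      unfolding open_family_def
    proof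
      show "\<forall>i\<in>S. openin T (topspace T - B i)"
        using S(1) B(1) by auto
      have "\<exists>i\<in>S. x \<notin> B i" if "x \<in> topspace T" for x
      proof (rule ccontr)
        assume "\<not> ?thesis"
        then have "S \<subseteq> {i \<in> I. x \<in> B i}"
          using S(1) by auto
        then have "Suc n \<le> card {i \<in> I. x \<in> B i}"
          using S(2) \<open>finite I\<close> card_mono[of "{i \<in> I. x \<in> B i}" S] by simp
        then show False
          using ord[OF that] by simp
      qed
      then show "(\<Union>i\<in>S. topspace T - B i) = topspace T"
        by auto
    qed
    from open_family_shrink_closure[OF assms(1) S(3) this]
    obtain V where V: "open_family T S V" "\<forall>i\<in>S. T closure_of (V i) \<subseteq> topspace T - B i"
      by blast
    have "(\<Union>i\<in>S. T closure_of (V i)) = topspace T"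
    proof
      show "(\<Union>i\<in>S. T closure_of (V i)) \<subseteq> topspace T"
        using V(2) by blast
      have "V i \<subseteq> T closure_of (V i)" if "i \<in> S" for i
        using V(1) that by (simp add: open_family_def closure_of_subset openin_subset)
      then show "topspace T \<subseteq> (\<Union>i\<in>S. T closure_of (V i))"
        using V(1) unfolding open_family_def by blast
    qed
    then have "(\<Inter>i\<in>S. topspace T - T closure_of (V i)) = {}"
      using S(4) by auto
    moreover have "B i \<subseteq> topspace T - T closure_of (V i)" if "i \<in> S" for i
      using closedin_subset[OF B(1)] V(2) S(1) that by blast
    ultimately show ?thesis
      by (intro exI[of _ "\<lambda>i. topspace T - T closure_of (V i)"]) (simp add: openin_diff)
  qed
  then obtain G where G: "\<And>S i. S \<in> \<S> \<Longrightarrow> i \<in> S \<Longrightarrow> openin T (G S i) \<and> B i \<subseteq> G S i"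
    "\<And>S. S \<in> \<S> \<Longrightarrow> (\<Inter>i\<in>S. G S i) = {}"
    by metis
  \<comment> \<open>Each \<open>S\<close> containing \<open>i\<close> imposes one condition on
    \<open>V i\<close>, finitely many in all. A point common to the sets \<open>V i\<close> with
    \<open>i\<close> in such an \<open>S\<close> would lie in the empty intersection of the sets
    \<open>G S i\<close>.\<close>
  define V where "V i = \<Inter>(insert (U i) ((\<lambda>S. G S i) ` {S \<in> \<S>. i \<in> S}))" for i
  show ?thesis
  proof (intro exI[of _ V] conjI ballI)
    show "openin T (V i)" if "i \<in> I" for i
      unfolding V_def using \<open>finite \<S>\<close> U[OF that] G(1) by (intro openin_Inter) auto
    show "B i \<subseteq> V i" "V i \<subseteq> U i" if "i \<in> I" for i
      using B(2)[OF that] G(1) by (auto simp: V_def)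
    show "card {i \<in> I. x \<in> V i} \<le> n" for x
    proof (rule ccontr)
      assume "\<not> ?thesis"
      then have "Suc n \<le> card {i \<in> I. x \<in> V i}"
        by simp
      then obtain S where S: "S \<subseteq> {i \<in> I. x \<in> V i}" "card S = Suc n"
        using obtain_subset_with_card_n by metis
      then have "S \<in> \<S>"
        by (auto simp: \<S>_def)
      moreover from this have "x \<in> (\<Inter>i\<in>S. G S i)"
        using S(1) by (auto simp: V_def)
      ultimately show False
        using G(2) by auto
    qed
  qed
qed

text \<open>On \<open>F\<close> the cover is replaced by a refinement \<open>W\<close> of small
  order, off \<open>F\<close> it is kept. The result is open: if the open set \<open>G\<close> cuts
  out \<open>W i\<close> on \<open>F\<close>, it equals \<open>U i\<close> intersected with the
  union of \<open>G\<close> and the complement of \<open>F\<close>. Bounding the order of the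
  closures lets the bound survive infinitely many such steps.\<close>

lemma covering_dim_le_closed_shrink:
  assumes "normal_space T" "closedin T F" "covering_dim_le (subtopology T F) n"
    "finite I" "open_family T I U"
  shows "\<exists>V. open_family T I V \<and> (\<forall>i\<in>I. T closure_of (V i) \<subseteq> U i) \<and>
    (\<forall>x\<in>F. card {i \<in> I. x \<in> T closure_of (V i)} \<le> n + 1)"
proof -
  have F: "F \<subseteq> topspace T" "openin T (topspace T - F)"
    using assms(2) by (auto simp: closedin_def)
  then have top: "topspace (subtopology T F) = F"
    by auto
  from covering_dim_leD[OF assms(3,4) open_family_subtopology[OF assms(5) F(1)]] obtain W
    where W: "open_family (subtopology T F) I W" "\<forall>i\<in>I. W i \<subseteq> U i \<inter> F"
      "\<forall>x\<in>F. card {i \<in> I. x \<in> W i} \<le> n + 1"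
    unfolding top by blast
  define U' where "U' i = W i \<union> (U i - F)" for i
  have "openin T (U' i)" if i: "i \<in> I" for i
  proof -
    obtain G where G: "openin T G" "W i = G \<inter> F"
      using W(1) i unfolding open_family_def openin_subtopology by blast
    have "openin T (U i)"
      using assms(5) that by (auto simp: open_family_def)
    then have "U' i = U i \<inter> (G \<union> (topspace T - F))"
      using G W(2) that openin_subset unfolding U'_def by blast
    then show ?thesis
      using G(1) F(2) \<open>openin T (U i)\<close> by auto
  qed
  moreover have "(\<Union>i\<in>I. U' i) = topspace T"
    using W(1,2) assms(5) top unfolding open_family_def U'_def by blast
  ultimately have "open_family T I U'"
    by (simp add: open_family_def)
  from open_family_shrink_closure[OF assms(1,4) this]
  obtain V where V: "open_family T I V" "\<forall>i\<in>I. T closure_of (V i) \<subseteq> U' i"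
    by blast
  show ?thesis
  proof (intro exI[of _ V] conjI ballI)
    show "T closure_of (V i) \<subseteq> U i" if "i \<in> I" for i
      using V(2) W(2) that unfolding U'_def by blast
    show "card {i \<in> I. x \<in> T closure_of (V i)} \<le> n + 1" if "x \<in> F" for x
    proof -
      have "{i \<in> I. x \<in> T closure_of (V i)} \<subseteq> {i \<in> I. x \<in> W i}"
        using V(2) that unfolding U'_def by blast
      from order.trans[OF card_mono[OF _ this] bspec[OF W(3) that]] show ?thesis
        using \<open>finite I\<close> by simp
    qed
  qed (fact V(1))
qed

text \<open>Pigeonhole, for use with decreasing families: a set that contains a point at infinitely
  many steps contains it at every step.\<close>

lemma infinitely_often_constant:
  assumes "finite I" "\<And>k::nat. s k \<in> I"
  shows "\<exists>i\<in>I. \<forall>k. \<exists>l\<ge>k. s l = i"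
proof -
  have "finite (range s)"
    using assms by (meson finite_subset image_subsetI)
  then obtain k0 where "infinite {k. s k = s k0}"
    using pigeonhole_infinite[of "UNIV :: nat set" s] by auto
  then show ?thesis
    using assms(2) by (metis (mono_tags) infinite_nat_iff_unbounded_le mem_Collect_eq)
qed

text \<open>The cover is refined successively, step \<open>k\<close> securing the order on
  \<open>F k\<close>. The intersections \<open>B i\<close> of the closures obey the bound
  everywhere. They still cover because \<open>I\<close> is finite: among the indices of members
  containing a given point, one recurs infinitely often. They are merely closed, so they are swollen
  to open sets at the end.\<close>

lemma covering_dim_le_countable_closed_sum:
  fixes F :: "nat \<Rightarrow> 'a set"
  assumes nT: "normal_space T"
    and F: "\<And>k. closedin T (F k)" "(\<Union>k. F k) = topspace T"
    and dim: "\<And>k. covering_dim_le (subtopology T (F k)) n"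
  shows "covering_dim_le T n"
proof (rule covering_dim_leI)
  fix I :: "'a set set" and U
  assume I: "finite I" and U: "open_family T I U"
  have "\<exists>G. \<forall>k. (open_family T I (G k) \<and> (\<forall>i\<in>I. G k i \<subseteq> U i)) \<and>
     ((\<forall>i\<in>I. T closure_of (G (Suc k) i) \<subseteq> G k i) \<and>
      (\<forall>x\<in>F k. card {i \<in> I. x \<in> T closure_of (G (Suc k) i)} \<le> n + 1))"
  proof (rule dependent_nat_choice)
    show "\<exists>V. open_family T I V \<and> (\<forall>i\<in>I. V i \<subseteq> U i)"
      using U by blast
    fix V k
    assume V: "open_family T I V \<and> (\<forall>i\<in>I. V i \<subseteq> U i)"
    then have "open_family T I V" by blast
    from covering_dim_le_closed_shrink[OF nT F(1) dim I this, of k] obtain W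
      where W: "open_family T I W" "\<forall>i\<in>I. T closure_of (W i) \<subseteq> V i"
      "\<forall>x\<in>F k. card {i \<in> I. x \<in> T closure_of (W i)} \<le> n + 1"
      by blast
    have "W i \<subseteq> T closure_of (W i)" if "i \<in> I" for i
      using W(1) that by (simp add: open_family_def closure_of_subset openin_subset)
    then have "\<forall>i\<in>I. W i \<subseteq> U i"
      using V W(2) by blast
    then show "\<exists>W. (open_family T I W \<and> (\<forall>i\<in>I. W i \<subseteq> U i)) \<and> (\<forall>i\<in>I. T closure_of (W i) \<subseteq> V i) \<and>
        (\<forall>x\<in>F k. card {i \<in> I. x \<in> T closure_of (W i)} \<le> n + 1)"
      using W by (intro exI[of _ W]) blast
  qed
  then obtain G where G: "\<And>k. open_family T I (G k)" "\<And>k i. i \<in> I \<Longrightarrow> G k i \<subseteq> U i"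
    "\<And>k i. i \<in> I \<Longrightarrow> T closure_of (G (Suc k) i) \<subseteq> G k i"
    "\<And>k x. x \<in> F k \<Longrightarrow> card {i \<in> I. x \<in> T closure_of (G (Suc k) i)} \<le> n + 1"
    by blast
  define B where "B i = (\<Inter>k. T closure_of (G (Suc k) i))" for i
  have Gcl: "G k i \<subseteq> T closure_of (G k i)" if "i \<in> I" for k i
    using G(1) that by (simp add: open_family_def closure_of_subset openin_subset)
  have Gmono: "G l i \<subseteq> G k i" if "k \<le> l" "i \<in> I" for k l i
    by (rule lift_Suc_antimono_le[of "\<lambda>k. G k i", OF _ that(1)])
      (use order.trans[OF Gcl G(3)] that(2) in blast)
  have Bcl: "closedin T (B i)" for i
    unfolding B_def by (rule closedin_Inter) auto
  have BU: "B i \<subseteq> U i" if "i \<in> I" for i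
    using G(2)[OF that, of 0] G(3)[OF that, of 0] unfolding B_def by blast
  have Bord: "card {i \<in> I. x \<in> B i} \<le> n + 1" if "x \<in> topspace T" for x
  proof -
    obtain k where "x \<in> F k"
      using F(2) \<open>x \<in> topspace T\<close> by blast
    have "{i \<in> I. x \<in> B i} \<subseteq> {i \<in> I. x \<in> T closure_of (G (Suc k) i)}"
      by (auto simp: B_def)
    from order.trans[OF card_mono[OF _ this] G(4)[OF \<open>x \<in> F k\<close>]] show ?thesis
      using I by simp
  qed
  have Bcov: "\<exists>i\<in>I. x \<in> B i" if x: "x \<in> topspace T" for x
  proof -
    have "\<exists>i. i \<in> I \<and> x \<in> G k i" for k
      using G(1)[of k] x by (auto simp: open_family_def)
    then obtain s where s: "\<And>k. s k \<in> I" "\<And>k. x \<in> G k (s k)"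
      by metis
    obtain i where i: "i \<in> I" "\<And>k. \<exists>l\<ge>k. s l = i"
      using infinitely_often_constant[of I s, OF I s(1)] by blast
    have "x \<in> G k i" for k
    proof -
      obtain l where "k \<le> l" "s l = i"
        using i(2) by blast
      then show ?thesis
        using s(2)[of l] Gmono[OF _ i(1), of k l] by blast
    qed
    then have "x \<in> B i"
      using Gcl[OF i(1)] by (auto simp: B_def)
    then show ?thesis
      using i(1) by blast
  qed
  have "openin T (U i)" if "i \<in> I" for i
    using U that by (simp add: open_family_def)
  from closed_family_swell[OF nT I Bcl BU this Bord] obtain V
    where V: "\<forall>i\<in>I. openin T (V i) \<and> B i \<subseteq> V i \<and> V i \<subseteq> U i"
      "\<forall>x\<in>topspace T. card {i \<in> I. x \<in> V i} \<le> n + 1"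
    by blast
  have "V i \<subseteq> topspace T" if "i \<in> I" for i
    using V(1) that by (simp add: openin_subset)
  then have "(\<Union>i\<in>I. V i) \<subseteq> topspace T"
    by (rule UN_least)
  moreover have "topspace T \<subseteq> (\<Union>i\<in>I. V i)"
  proof
    fix x assume "x \<in> topspace T"
    then obtain i where "i \<in> I" "x \<in> B i"
      using Bcov by blast
    then show "x \<in> (\<Union>i\<in>I. V i)"
      using bspec[OF V(1) \<open>i \<in> I\<close>] by blast
  qed
  ultimately have "(\<Union>i\<in>I. V i) = topspace T"
    by (rule antisym)
  then have "open_family T I V"
    using V(1) unfolding open_family_def by blast
  then show "\<exists>V. open_family T I V \<and> (\<forall>i\<in>I. V i \<subseteq> U i) \<and>
      (\<forall>x\<in>topspace T. card {i \<in> I. x \<in> V i} \<le> n + 1)"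
    using V by (intro exI[of _ V]) blast
qed

subsection \<open>The amalgam of copies of a metric space\<close>

text \<open>A relation instead of a function, so that converses and increasing unions stay of the
  same kind. In a metric space it is single-valued and injective, because distance 0 is preserved
  both ways.\<close>

definition partial_isometry :: "'a set \<Rightarrow> ('a \<Rightarrow> 'a \<Rightarrow> real) \<Rightarrow> ('a \<times> 'a) set \<Rightarrow> bool" where
  "partial_isometry M d R \<longleftrightarrow>
     R \<subseteq> M \<times> M \<and> (\<forall>p\<in>R. \<forall>q\<in>R. d (fst p) (fst q) = d (snd p) (snd q))"

text \<open>Closedness in the form in which gluing uses it: \<open>e\<close> bounds the distance of
  a new point from the old ones from below.\<close>

definition separated_in :: "'a set \<Rightarrow> ('a \<Rightarrow> 'a \<Rightarrow> real) \<Rightarrow> 'a set \<Rightarrow> bool" where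
  "separated_in M d A \<longleftrightarrow> (\<forall>x\<in>M - A. \<exists>e>0. \<forall>a\<in>A. e \<le> d x a)"

lemma (in Metric_space) closedin_iff_separated:
  assumes "A \<subseteq> M"
  shows "closedin mtopology A \<longleftrightarrow> separated_in M d A"
proof -
  have "disjnt A (mball x r) \<longleftrightarrow> (\<forall>a\<in>A. r \<le> d x a)" if "x \<in> M" for x r
    using that assms by (auto simp: disjnt_iff not_less)
  then show ?thesis
    using assms unfolding closedin_metric separated_in_def by auto
qed

lemma (in Metric_space) finite_separated:
  assumes "finite A" "A \<subseteq> M"
  shows "separated_in M d A"
  using assms closedin_iff_separated closedin_Hausdorff_finite[OF Hausdorff_space_mtopology]
  by simp

lemma partial_isometry_converse: "partial_isometry M d R \<Longrightarrow> partial_isometry M d (R\<inverse>)"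
  unfolding partial_isometry_def by fastforce

text \<open>Two values at one point have distance 0, so the relation is the graph of an isometry.
  This later carries dimension bounds from \<open>M\<close> to its copies.\<close>

lemma (in Metric_space) partial_isometry_homeomorphic_space:
  assumes "partial_isometry M d R"
  shows "subtopology mtopology (Domain R) homeomorphic_space subtopology mtopology (Range R)"
proof -
  have R: "Domain R \<subseteq> M" "Range R \<subseteq> M"
    using assms by (auto simp: partial_isometry_def)
  have iso: "d x x' = d y y'" if "(x, y) \<in> R" "(x', y') \<in> R" for x y x' y'
    using assms that unfolding partial_isometry_def by fastforce
  define h where "h x = (SOME y. (x, y) \<in> R)" for x
  have h: "(x, h x) \<in> R" if "x \<in> Domain R" for x
    using that unfolding h_def by (auto intro: someI)
  have "y = h x" if "(x, y) \<in> R" for x y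
  proof -
    have x: "x \<in> Domain R"
      using that by blast
    then have "d y (h x) = d x x"
      using iso[OF that h] by simp
    then show ?thesis
      using h[OF x] that x R by (metis Range.intros subsetD zero)
  qed
  then have im: "h ` Domain R = Range R"
    using h by (auto simp: image_iff) 
  interpret Metric_space12 "Domain R" d "Range R" d
    unfolding Metric_space12_def using subspace R by blast
  have "homeomorphic_map M1.mtopology M2.mtopology h"
    using im iso[OF h h, symmetric] by (intro isometry_imp_homeomorphic_map) auto
  moreover have "M1.mtopology = subtopology mtopology (Domain R)"
    "M2.mtopology = subtopology mtopology (Range R)"
    using R by (auto intro!: Submetric.mtopology_submetric
      simp: Submetric_def Submetric_axioms_def Metric_space_axioms)
  ultimately show ?thesis
    using homeomorphic_map_imp_homeomorphic_space by metis
qed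

lemma (in Metric_space) subtopology_eq_mtopology:
  assumes "A \<subseteq> M" "Metric_space A d'" "\<And>x y. x \<in> A \<Longrightarrow> y \<in> A \<Longrightarrow> d x y = d' x y"
  shows "subtopology mtopology A = Metric_space.mtopology A d'"
proof -
  interpret A': Metric_space A d' by fact
  interpret A: Submetric M d A
    using assms(1) by unfold_locales
  have "A.sub.mball x r = A'.mball x r" if "x \<in> A" for x r
    using assms(3) that by (auto simp: A.sub.in_mball A'.in_mball)
  then have "openin A.sub.mtopology U = openin A'.mtopology U" for U
    unfolding A.sub.openin_mtopology A'.openin_mtopology by (metis subsetD)
  then show ?thesis
    by (metis A.mtopology_submetric topology_eq)
qed

text \<open>For each \<open>i\<close>, a copy of \<open>M\<close> is glued to \<open>M\<close> by identifying \<open>x\<close> in the copy with \<open>y\<close> for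
  \<open>(x, y) \<in> R i\<close>. The points of the copies that are not identified with old ones form \<open>N\<close>, and
  \<open>u \<in> N\<close> is the point \<open>base u\<close> of copy \<open>idx u\<close>.\<close>

locale star_amalgam = Metric_space M d for M :: "'u set" and d +
  fixes N :: "'u set" and idx :: "'u \<Rightarrow> 'i" and base :: "'u \<Rightarrow> 'u" and R :: "'i \<Rightarrow> ('u \<times> 'u) set"
  assumes disj: "N \<inter> M = {}"
    and base_inj: "\<And>u v. \<lbrakk>u \<in> N; v \<in> N; idx u = idx v; base u = base v\<rbrakk> \<Longrightarrow> u = v"
    and base_in: "\<And>u. u \<in> N \<Longrightarrow> base u \<in> M - Domain (R (idx u))"
    and base_surj: "\<And>i x. \<lbrakk>R i \<noteq> {}; x \<in> M - Domain (R i)\<rbrakk> \<Longrightarrow> \<exists>u\<in>N. idx u = i \<and> base u = x"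
    and R_ne: "\<And>u. u \<in> N \<Longrightarrow> R (idx u) \<noteq> {}"
    and R_iso: "\<And>i. partial_isometry M d (R i)"
    and R_dom: "\<And>i. separated_in M d (Domain (R i))"
    and R_ran: "\<And>i. separated_in M d (Range (R i))"
begin

text \<open>Points of \<open>M\<close> are treated as a further copy of \<open>M\<close>, glued to \<open>M\<close> along the identity.\<close>

definition pt :: "'u \<Rightarrow> 'u" where
  "pt u = (if u \<in> N then base u else u)"

definition glue :: "'u \<Rightarrow> ('u \<times> 'u) set" where
  "glue u = (if u \<in> N then R (idx u) else Id_on M)"

definition same_copy :: "'u \<Rightarrow> 'u \<Rightarrow> bool" where
  "same_copy u v \<longleftrightarrow> (if u \<in> N \<and> v \<in> N then idx u = idx v else u \<notin> N \<and> v \<notin> N)"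

definition K :: "'u \<Rightarrow> 'u \<Rightarrow> real" where
  "K u z = (INF p\<in>glue u. d (pt u) (fst p) + d (snd p) z)"

text \<open>\<open>K u\<close> is the function of distances from \<open>u\<close> to the points of \<open>M\<close>. All copies are
  amalgamated over \<open>M\<close>, so points of different copies are joined through \<open>M\<close>.\<close>

definition D :: "'u \<Rightarrow> 'u \<Rightarrow> real" where
  "D u v =
     (if u \<notin> M \<union> N \<or> v \<notin> M \<union> N then 0
      else if same_copy u v then d (pt u) (pt v)
      else INF z\<in>M. K u z + K v z)"

text \<open>For nonempty \<open>R i\<close>, the graph of the map of \<open>M\<close> onto copy
  \<open>i\<close>: a glued point goes to its partner under \<open>R i\<close>, any other point to
  the new point above it.\<close>

definition ext :: "'i \<Rightarrow> ('u \<times> 'u) set" where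
  "ext i = R i \<union> {(base u, u) |u. u \<in> N \<and> idx u = i}"

lemma same_copy_refl: "same_copy u u"
  and same_copy_sym: "same_copy u v \<Longrightarrow> same_copy v u"
  and same_copy_trans: "same_copy u v \<Longrightarrow> same_copy v w \<Longrightarrow> same_copy u w"
  by (auto simp: same_copy_def split: if_splits)

lemma glue_same_copy: "same_copy u v \<Longrightarrow> glue u = glue v"
  by (auto simp: same_copy_def glue_def split: if_splits)

lemma pt_in: "u \<in> M \<union> N \<Longrightarrow> pt u \<in> M"
  using base_in by (auto simp: pt_def)

lemma glue_ne: "u \<in> M \<union> N \<Longrightarrow> glue u \<noteq> {}"
  using R_ne by (auto simp: glue_def)

lemma glue_iso: "partial_isometry M d (glue u)"
  using R_iso by (auto simp: glue_def partial_isometry_def)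

lemma glue_in: "p \<in> glue u \<Longrightarrow> fst p \<in> M \<and> snd p \<in> M"
  using glue_iso[of u] unfolding partial_isometry_def by (cases p) auto

lemma glue_dist: "p \<in> glue u \<Longrightarrow> q \<in> glue u \<Longrightarrow> d (fst p) (fst q) = d (snd p) (snd q)"
  using glue_iso unfolding partial_isometry_def by blast

section \<open>Distances from a point of a copy to \<open>M\<close>\<close>

lemma K_le: "p \<in> glue u \<Longrightarrow> K u z \<le> d (pt u) (fst p) + d (snd p) z"
  unfolding K_def by (rule cINF_lower) (auto intro!: bdd_belowI2[where m = 0])

lemma K_ge:
  assumes "u \<in> M \<union> N" "\<And>p. p \<in> glue u \<Longrightarrow> c \<le> d (pt u) (fst p) + d (snd p) z"
  shows "c \<le> K u z"
  unfolding K_def using glue_ne[OF assms(1)] assms(2) by (rule cINF_greatest)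

lemma K_nonneg: "u \<in> M \<union> N \<Longrightarrow> 0 \<le> K u z"
  by (rule K_ge) auto

text \<open>With \<open>K_sum_ge\<close> this makes \<open>K u\<close> a Katetov function on
  \<open>M\<close>: these are the inequalities that the distances from one additional point must
  satisfy.\<close>

lemma K_lipschitz:
  assumes "u \<in> M \<union> N" "z \<in> M" "z' \<in> M"
  shows "K u z \<le> K u z' + d z' z"
proof -
  have "K u z - d z' z \<le> K u z'"
  proof (rule K_ge[OF assms(1)])
    fix p assume p: "p \<in> glue u"
    show "K u z - d z' z \<le> d (pt u) (fst p) + d (snd p) z'"
      using K_le[OF p, of z] triangle[of "snd p" z' z] glue_in[OF p] assms by auto
  qed
  then show ?thesis by simp
qed

text \<open>Here the isometry of the gluing enters. The distance between two glued points is
  measured inside the copy, where it is bounded by way of \<open>pt u\<close>.\<close>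

lemma K_sum_ge:
  assumes "u \<in> M \<union> N" "z \<in> M" "z' \<in> M"
  shows "d z z' \<le> K u z + K u z'"
proof -
  have "d z z' - K u z' \<le> K u z"
  proof (rule K_ge[OF assms(1)])
    fix p assume p: "p \<in> glue u"
    have "d z z' - (d (pt u) (fst p) + d (snd p) z) \<le> K u z'"
    proof (rule K_ge[OF assms(1)])
      fix q assume q: "q \<in> glue u"
      have "d z z' \<le> d z (snd p) + d (snd p) (snd q) + d (snd q) z'"
        using triangle[of z "snd p" z'] triangle[of "snd p" "snd q" z'] glue_in[OF p] glue_in[OF q] assms
        by auto
      moreover have "d (fst p) (fst q) \<le> d (pt u) (fst p) + d (pt u) (fst q)"
        using triangle[of "fst p" "pt u" "fst q"] glue_in[OF p] glue_in[OF q] pt_in[OF assms(1)] commute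
        by simp
      ultimately show "d z z' - (d (pt u) (fst p) + d (snd p) z) \<le> d (pt u) (fst q) + d (snd q) z'"
        using glue_dist[OF p q] commute[of z "snd p"] by linarith
    qed
    then show "d z z' - K u z' \<le> d (pt u) (fst p) + d (snd p) z"
      by simp
  qed
  then show ?thesis by simp
qed

lemma K_same_copy:
  assumes "u \<in> M \<union> N" "v \<in> M \<union> N" "same_copy u v" "z \<in> M"
  shows "K u z \<le> d (pt u) (pt v) + K v z"
proof -
  have "K u z - d (pt u) (pt v) \<le> K v z"
  proof (rule K_ge[OF assms(2)])
    fix p assume p: "p \<in> glue v"
    then have p': "p \<in> glue u"
      using glue_same_copy[OF assms(3)] by simp
    show "K u z - d (pt u) (pt v) \<le> d (pt v) (fst p) + d (snd p) z"
      using K_le[OF p', of z] triangle[of "pt u" "pt v" "fst p"] glue_in[OF p]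
        pt_in[OF assms(1)] pt_in[OF assms(2)] by auto
  qed
  then show ?thesis by simp
qed

text \<open>The transfer opposite to that in \<open>K_sum_ge\<close>: the distance between two glued
  points is measured in \<open>M\<close>, by way of \<open>z\<close>. Hence a detour through
  \<open>M\<close> never shortens a distance inside a copy.\<close>

lemma dist_le_K_sum:
  assumes "u \<in> M \<union> N" "v \<in> M \<union> N" "same_copy u v" "z \<in> M"
  shows "d (pt u) (pt v) \<le> K u z + K v z"
proof -
  have "d (pt u) (pt v) - K v z \<le> K u z"
  proof (rule K_ge[OF assms(1)])
    fix p assume p: "p \<in> glue u"
    have "d (pt u) (pt v) - (d (pt u) (fst p) + d (snd p) z) \<le> K v z"
    proof (rule K_ge[OF assms(2)])
      fix q assume "q \<in> glue v"
      then have q: "q \<in> glue u"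
        using glue_same_copy[OF assms(3)] by simp
      have "d (pt u) (pt v) \<le> d (pt u) (fst p) + d (fst p) (fst q) + d (pt v) (fst q)"
        using triangle[of "pt u" "fst p" "pt v"] triangle[of "fst p" "fst q" "pt v"] commute[of "pt v" "fst q"]
          glue_in[OF p] glue_in[OF q] pt_in[OF assms(1)] pt_in[OF assms(2)] by auto
      moreover have "d (snd p) (snd q) \<le> d (snd p) z + d (snd q) z"
        using triangle[of "snd p" z "snd q"] glue_in[OF p] glue_in[OF q] assms(4) commute[of z "snd q"]
        by auto
      ultimately show "d (pt u) (pt v) - (d (pt u) (fst p) + d (snd p) z) \<le> d (pt v) (fst q) + d (snd q) z"
        using glue_dist[OF p q] by linarith
    qed
    then show "d (pt u) (pt v) - K v z \<le> d (pt u) (fst p) + d (snd p) z"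
      by simp
  qed
  then show ?thesis by simp
qed

lemma K_old:
  assumes "x \<in> M" "z \<in> M"
  shows "K x z = d x z"
proof (rule antisym)
  have "x \<notin> N"
    using assms disj by auto
  then have eq: "pt x = x" "glue x = Id_on M"
    by (auto simp: pt_def glue_def)
  show "K x z \<le> d x z"
    using K_le[of "(x, x)" x z] eq assms by auto
  show "d x z \<le> K x z"
  proof (rule K_ge)
    fix p assume "p \<in> glue x"
    then show "d x z \<le> d (pt x) (fst p) + d (snd p) z"
      using eq triangle[of x "fst p" z] assms by auto
  qed (use assms in auto)
qed

text \<open>A path from \<open>u\<close> to \<open>M\<close> leaves the copy at a point of the
  domain of the gluing. The domain is closed and misses \<open>base u\<close>, which bounds this
  first leg.\<close>

lemma K_new_bound:
  assumes "u \<in> N"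
  shows "\<exists>e>0. \<forall>z. e \<le> K u z"
proof -
  obtain e where e: "e > 0" "\<And>a. a \<in> Domain (R (idx u)) \<Longrightarrow> e \<le> d (base u) a"
    using R_dom[of "idx u"] base_in[OF assms] unfolding separated_in_def by blast
  have "e \<le> K u z" for z
  proof (rule K_ge)
    fix p assume "p \<in> glue u"
    then have "fst p \<in> Domain (R (idx u))"
      using assms by (cases p) (auto simp: glue_def)
    then have "e \<le> d (pt u) (fst p)"
      using e(2) assms by (simp add: pt_def)
    then show "e \<le> d (pt u) (fst p) + d (snd p) z"
      using nonneg[of "snd p" z] by linarith
  qed (use assms in auto)
  then show ?thesis
    using e(1) by blast
qed

section \<open>The amalgam distance is a metric\<close>

lemma M_ne: "u \<in> M \<union> N \<Longrightarrow> M \<noteq> {}"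
  using pt_in by auto

lemma D_same_copy: "u \<in> M \<union> N \<Longrightarrow> v \<in> M \<union> N \<Longrightarrow> same_copy u v \<Longrightarrow> D u v = d (pt u) (pt v)"
  by (simp add: D_def)

lemma D_le_K_sum:
  assumes "u \<in> M \<union> N" "v \<in> M \<union> N" "z \<in> M"
  shows "D u v \<le> K u z + K v z"
proof (cases "same_copy u v")
  case True
  then show ?thesis
    using dist_le_K_sum assms by (simp add: D_same_copy)
next
  case False
  have "(INF z\<in>M. K u z + K v z) \<le> K u z + K v z"
    using assms K_nonneg by (intro cINF_lower bdd_belowI2[where m = 0]) (auto intro: add_nonneg_nonneg)
  then show ?thesis
    using False assms by (simp add: D_def)
qed

lemma D_ge:
  assumes "u \<in> M \<union> N" "v \<in> M \<union> N" "\<not> same_copy u v" "\<And>z. z \<in> M \<Longrightarrow> c \<le> K u z + K v z"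
  shows "c \<le> D u v"
proof -
  have "c \<le> (INF z\<in>M. K u z + K v z)"
    using M_ne[OF assms(1)] assms(4) by (rule cINF_greatest)
  then show ?thesis
    using assms(1-3) by (simp add: D_def)
qed

lemma D_old: "x \<in> M \<Longrightarrow> y \<in> M \<Longrightarrow> D x y = d x y"
  using disj by (auto simp: D_def same_copy_def pt_def)

lemma D_commute: "D u v = D v u"
  using same_copy_sym by (auto simp: D_def commute add.commute)

lemma D_nonneg: "0 \<le> D u v"
proof (cases "u \<in> M \<union> N \<and> v \<in> M \<union> N \<and> \<not> same_copy u v")
  case True
  then show ?thesis
    using K_nonneg by (intro D_ge) (auto intro: add_nonneg_nonneg)
next
  case False
  then show ?thesis
    by (auto simp: D_def)
qed

text \<open>Copies meet only in \<open>M\<close>, so the bound for the distance from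
  \<open>u\<close> to \<open>M\<close> serves for all points outside the copy of \<open>u\<close>.
  It yields both that \<open>D\<close> separates points and that \<open>M\<close> is closed in the
  amalgam.\<close>

lemma D_new_bound:
  assumes "u \<in> N"
  shows "\<exists>e>0. \<forall>v\<in>M \<union> N. \<not> same_copy u v \<longrightarrow> e \<le> D u v"
proof -
  obtain e where e: "e > 0" "\<And>z. e \<le> K u z"
    using K_new_bound[OF assms] by blast
  have "e \<le> D u v" if "v \<in> M \<union> N" "\<not> same_copy u v" for v
    using assms that K_nonneg[of v] e(2) by (intro D_ge) (auto intro: add_increasing2)
  then show ?thesis
    using e(1) by blast
qed

lemma D_triangle:
  assumes "u \<in> M \<union> N" "v \<in> M \<union> N" "w \<in> M \<union> N"
  shows "D u w \<le> D u v + D v w"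
proof (cases "same_copy u v")
  case uv: True
  show ?thesis
  proof (cases "same_copy v w")
    case True
    then have "same_copy u w"
      using uv same_copy_trans by blast
    then show ?thesis
      using uv True triangle[of "pt u" "pt v" "pt w"] pt_in assms by (simp add: D_same_copy)
  next
    case False
    have "D u w - D u v \<le> D v w"
    proof (rule D_ge[OF assms(2,3) False])
      fix z assume z: "z \<in> M"
      show "D u w - D u v \<le> K v z + K w z"
        using D_le_K_sum[OF assms(1,3) z] K_same_copy[OF assms(1,2) uv z] D_same_copy[OF assms(1,2) uv]
        by linarith
    qed
    then show ?thesis by simp
  qed
next
  case uv: False
  show ?thesis
  proof (cases "same_copy v w")
    case True
    have "D u w - D v w \<le> D u v"
    proof (rule D_ge[OF assms(1,2) uv])
      fix z assume z: "z \<in> M"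
      show "D u w - D v w \<le> K u z + K v z"
        using D_le_K_sum[OF assms(1,3) z] K_same_copy[OF assms(3,2) same_copy_sym[OF True] z]
          D_same_copy[OF assms(3,2) same_copy_sym[OF True]] D_commute[of w v]
        by linarith
    qed
    then show ?thesis by simp
  next
    case False
    have "D u w - D u v \<le> D v w"
    proof (rule D_ge[OF assms(2,3) False])
      fix z assume z: "z \<in> M"
      \<comment> \<open>Let the route from \<open>u\<close> to \<open>v\<close> cross
        \<open>M\<close> at \<open>z'\<close> and the route from \<open>v\<close> to
        \<open>w\<close> cross it at \<open>z\<close>. By \<open>K_sum_ge\<close> the detour through
        \<open>v\<close> is no shorter than \<open>d z' z\<close>, which leaves a route from
        \<open>u\<close> to \<open>w\<close> through \<open>z\<close>. This also covers
        \<open>u\<close> and \<open>w\<close> in a common copy.\<close>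
      have "D u w - (K v z + K w z) \<le> D u v"
      proof (rule D_ge[OF assms(1,2) uv])
        fix z' assume z': "z' \<in> M"
        show "D u w - (K v z + K w z) \<le> K u z' + K v z'"
          using D_le_K_sum[OF assms(1,3) z] K_lipschitz[OF assms(1) z z'] K_sum_ge[OF assms(2) z' z]
          by linarith
      qed
      then show "D u w - D u v \<le> K v z + K w z" by simp
    qed
    then show ?thesis by simp
  qed
qed

lemma D_eq_0_iff:
  assumes "u \<in> M \<union> N" "v \<in> M \<union> N"
  shows "D u v = 0 \<longleftrightarrow> u = v"
proof (cases "same_copy u v")
  case True
  have "pt u = pt v \<longleftrightarrow> u = v"
    using True base_inj assms by (auto simp: pt_def same_copy_def split: if_splits)
  then show ?thesis
    using D_same_copy[OF assms True] pt_in assms by auto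
next
  case False
  \<comment> \<open>All old points form one copy, so one of the two points is new and
    \<open>D_new_bound\<close> applies to it.\<close>
  then have "u \<in> N \<or> v \<in> N" "\<not> same_copy v u"
    using same_copy_sym by (auto simp: same_copy_def)
  then have "D u v > 0"
    using D_new_bound[of u] D_new_bound[of v] False assms D_commute[of u v] by fastforce
  then show ?thesis
    using False same_copy_refl by auto
qed

sublocale amalgam: Metric_space "M \<union> N" D
  by unfold_locales (auto simp: D_nonneg D_commute D_eq_0_iff intro: D_triangle)

section \<open>The extended isometries\<close>

lemma D_new_old:
  assumes "u \<in> N" "z \<in> M"
  shows "D z u = K u z"
proof (rule antisym)
  have ns: "\<not> same_copy z u"
    using assms disj by (auto simp: same_copy_def)
  show "D z u \<le> K u z"
    using D_le_K_sum[of z u z] K_old[of z z] assms by simp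
  show "K u z \<le> D z u"
  proof (rule D_ge[OF _ _ ns])
    fix z' assume "z' \<in> M"
    then show "K u z \<le> K z z' + K u z'"
      using K_lipschitz[of u z z'] K_old[of z z'] assms commute[of z' z] by auto
  qed (use assms in auto)
qed

lemma same_copy_new: "u \<in> N \<Longrightarrow> v \<in> N \<Longrightarrow> same_copy u v \<longleftrightarrow> idx u = idx v"
  by (simp add: same_copy_def)

lemma not_same_copy_old: "u \<in> N \<Longrightarrow> z \<in> M \<Longrightarrow> \<not> same_copy u z"
  using disj by (auto simp: same_copy_def)

text \<open>Seen from the copy, \<open>snd p\<close> is the point \<open>fst p\<close>. The pair
  \<open>p\<close> itself gives a path of the stated length, and a path through another pair
  \<open>q\<close> is no shorter because \<open>R\<close> preserves distances.\<close>

lemma D_new_glued: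
  assumes "u \<in> N" "p \<in> R (idx u)"
  shows "D (snd p) u = d (fst p) (base u)"
proof -
  have p: "p \<in> glue u" and pt: "pt u = base u"
    using assms by (auto simp: glue_def pt_def)
  have "K u (snd p) = d (fst p) (base u)"
  proof (rule antisym)
    show "K u (snd p) \<le> d (fst p) (base u)"
      using K_le[OF p, of "snd p"] pt glue_in[OF p] commute by simp
    show "d (fst p) (base u) \<le> K u (snd p)"
    proof (rule K_ge)
      fix q assume q: "q \<in> glue u"
      show "d (fst p) (base u) \<le> d (pt u) (fst q) + d (snd q) (snd p)"
        using triangle[of "base u" "fst q" "fst p"] glue_dist[OF q p] glue_in[OF p] glue_in[OF q]
          pt_in[of u] pt assms commute[of "fst p" "base u"] by auto
    qed (use assms in auto)
  qed
  then show ?thesis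
    using D_new_old[of u "snd p"] glue_in[OF p] assms by simp
qed

lemma ext_partial_isometry: "partial_isometry (M \<union> N) D (ext i)"
  unfolding partial_isometry_def
proof (intro conjI ballI)
  have R: "R i \<subseteq> M \<times> M"
    using R_iso[of i] by (simp add: partial_isometry_def)
  then show "ext i \<subseteq> (M \<union> N) \<times> (M \<union> N)"
    using base_in by (auto simp: ext_def)
  fix p q assume pq: "p \<in> ext i" "q \<in> ext i"
  consider "p \<in> R i" "q \<in> R i"
    | u where "p \<in> R i" "u \<in> N" "idx u = i" "q = (base u, u)"
    | u where "q \<in> R i" "u \<in> N" "idx u = i" "p = (base u, u)"
    | u v where "u \<in> N" "idx u = i" "p = (base u, u)" "v \<in> N" "idx v = i" "q = (base v, v)"
    using pq unfolding ext_def by blast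
  then show "D (fst p) (fst q) = D (snd p) (snd q)"
  proof cases
    case 1
    then have "d (fst p) (fst q) = d (snd p) (snd q)"
      using R_iso[of i] unfolding partial_isometry_def by blast
    then show ?thesis
      using 1 R D_old by (metis mem_Times_iff subsetD)
  next
    case 2
    then have "fst p \<in> M" "base u \<in> M"
      using R base_in by auto
    then show ?thesis
      using 2 D_new_glued[of u p] D_old by simp
  next
    case 3
    then have "fst q \<in> M" "base u \<in> M"
      using R base_in by auto
    then show ?thesis
      using 3 D_new_glued[of u q] D_old D_commute[of u] D_commute[of "base u"] by simp
  next
    case 4
    then show ?thesis
      using D_same_copy[of u v] same_copy_new[of u v] base_in D_old by (simp add: pt_def)
  qed
qed

lemma Domain_ext:
  assumes "R i \<noteq> {}"
  shows "Domain (ext i) = M"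
proof -
  have "Domain (R i) \<subseteq> M"
    using R_iso[of i] by (auto simp: partial_isometry_def)
  then show ?thesis
  proof (intro equalityI subsetI)
    fix x assume "x \<in> M"
    then show "x \<in> Domain (ext i)"
      using base_surj[OF assms, of x] unfolding ext_def by (cases "x \<in> Domain (R i)") auto
  next
    fix x assume "x \<in> Domain (ext i)"
    then show "x \<in> M"
      using \<open>Domain (R i) \<subseteq> M\<close> base_in unfolding ext_def by auto
  qed
qed

lemma ext_empty: "R i = {} \<Longrightarrow> ext i = {}"
  using R_ne unfolding ext_def by blast

lemma old_separated: "separated_in (M \<union> N) D M"
  unfolding separated_in_def
proof
  fix u assume "u \<in> M \<union> N - M"
  then have "u \<in> N" by auto
  from D_new_bound[OF this] obtain e where "e > 0" "\<forall>v\<in>M \<union> N. \<not> same_copy u v \<longrightarrow> e \<le> D u v"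
    by blast
  then show "\<exists>e>0. \<forall>a\<in>M. e \<le> D u a"
    using not_same_copy_old[OF \<open>u \<in> N\<close>] by (intro exI[of _ e]) simp
qed

text \<open>At the next stage the converse is glued, so this range becomes a domain. A new point off
  the range lies in another copy; for an old one, every path to the new points of copy
  \<open>i\<close> enters through the closed set \<open>Range (R i)\<close>.\<close>

lemma Range_ext_separated: "separated_in (M \<union> N) D (Range (ext i))"
  unfolding separated_in_def
proof
  fix w assume w: "w \<in> M \<union> N - Range (ext i)"
  have Rm: "Range (R i) \<subseteq> M"
    using R_iso[of i] by (auto simp: partial_isometry_def)
  have ran: "y \<in> Range (R i) \<or> y \<in> N \<and> idx y = i" if "y \<in> Range (ext i)" for y
    using that by (auto simp: ext_def)
  show "\<exists>e>0. \<forall>a\<in>Range (ext i). e \<le> D w a"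
  proof (cases "w \<in> N")
    case True
    have "idx w \<noteq> i"
      using w True by (auto simp: ext_def)
    then have "\<not> same_copy w y \<and> y \<in> M \<union> N" if "y \<in> Range (ext i)" for y
      using ran[OF that] True not_same_copy_old[OF True] same_copy_new[OF True] Rm by auto
    moreover obtain e where "e > 0" "\<forall>v\<in>M \<union> N. \<not> same_copy w v \<longrightarrow> e \<le> D w v"
      using D_new_bound[OF True] by blast
    ultimately show ?thesis
      by (intro exI[of _ e]) simp
  next
    case False
    then have wM: "w \<in> M - Range (R i)"
      using w by (auto simp: ext_def)
    then obtain e where e: "e > 0" "\<And>b. b \<in> Range (R i) \<Longrightarrow> e \<le> d w b"
      using R_ran[of i] unfolding separated_in_def by blast
    have "e \<le> D w y" if "y \<in> Range (ext i)" for y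
      using ran[OF that]
    proof
      assume "y \<in> Range (R i)"
      then show ?thesis
        using e(2) Rm wM D_old by fastforce
    next
      assume y: "y \<in> N \<and> idx y = i"
      have "e \<le> K y w"
      proof (rule K_ge)
        fix p assume "p \<in> glue y"
        then have "snd p \<in> Range (R i)"
          using y by (cases p) (auto simp: glue_def)
        then show "e \<le> d (pt y) (fst p) + d (snd p) w"
          using e(2) commute[of w] nonneg[of "pt y" "fst p"] by (metis add_increasing)
      qed (use y in auto)
      then show ?thesis
        using D_new_old[of y w] y wM by simp
    qed
    then show ?thesis
      using e(1) by blast
  qed
qed

section \<open>Dimension of the amalgam\<close>

lemma closedin_old: "closedin amalgam.mtopology M"
  using amalgam.closedin_iff_separated old_separated by blast

lemma subtopology_old: "subtopology amalgam.mtopology M = mtopology"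
  using D_old by (intro amalgam.subtopology_eq_mtopology Metric_space_axioms) auto

lemma covering_dim_le_Range_ext:
  assumes "covering_dim_le mtopology n" "R i \<noteq> {}"
  shows "covering_dim_le (subtopology amalgam.mtopology (Range (ext i))) n"
  using amalgam.partial_isometry_homeomorphic_space[OF ext_partial_isometry, of i]
    homeomorphic_covering_dim_le assms
  by (simp add: Domain_ext subtopology_old)

lemma covering_dim_le_amalgam:
  assumes "covering_dim_le mtopology n"
  shows "covering_dim_le amalgam.mtopology n"
proof -
  let ?T = amalgam.mtopology
  define F where "F k = {u \<in> M \<union> N. \<forall>z\<in>M. inverse (real (Suc k)) \<le> D u z}" for k
  have F_new: "F k \<subseteq> N" for k
  proof
    fix u assume u: "u \<in> F k"
    have "\<not> inverse (real (Suc k)) \<le> D u u"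
      using u by (simp add: F_def)
    then show "u \<in> N"
      using u by (auto simp: F_def)
  qed
  have F_closed: "closedin ?T (F k)" for k
  proof -
    have "F k \<subseteq> M \<union> N"
      by (auto simp: F_def)
    moreover have "separated_in (M \<union> N) D (F k)"
      unfolding separated_in_def
    proof
      fix w assume w: "w \<in> M \<union> N - F k"
      then obtain z where z: "z \<in> M" "D w z < inverse (real (Suc k))"
        by (auto simp: F_def not_le)
      have "inverse (real (Suc k)) - D w z \<le> D w a" if "a \<in> F k" for a
      proof -
        have "a \<in> M \<union> N" "inverse (real (Suc k)) \<le> D a z"
          using that z(1) by (auto simp: F_def)
        then show ?thesis
          using D_triangle[of a w z] D_commute[of a w] w z(1) by auto
      qed
      then show "\<exists>e>0. \<forall>a\<in>F k. e \<le> D w a"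
        using z(2) by (intro exI[of _ "inverse (real (Suc k)) - D w z"]) auto
    qed
    ultimately show ?thesis
      using amalgam.closedin_iff_separated by blast
  qed
  \<comment> \<open>A path between different copies passes through \<open>M\<close>, and its part
    from \<open>u\<close> to \<open>M\<close> already has at least this length.\<close>
  have F_far: "inverse (real (Suc k)) \<le> D u v" if "u \<in> F k" "v \<in> F k" "idx u \<noteq> idx v" for k u v
  proof -
    have uv: "u \<in> N" "v \<in> N"
      using that F_new by auto
    show ?thesis
    proof (rule D_ge)
      fix z assume z: "z \<in> M"
      have "inverse (real (Suc k)) \<le> D u z"
        using that(1) z by (simp add: F_def)
      then show "inverse (real (Suc k)) \<le> K u z + K v z"
        using D_new_old[OF uv(1) z] K_nonneg[of v z] uv D_commute[of u z] by simp
    qed (use uv that(3) same_copy_new in auto)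
  qed
  have F_dim: "covering_dim_le (subtopology ?T (F k)) n" for k
  proof (rule covering_dim_le_disjoint_open_Union)
    define C where "C i = {u \<in> F k. idx u = i}" for i
    have top: "topspace (subtopology ?T (F k)) = F k"
      by (auto simp: F_def)
    show "(\<Union>i\<in>idx ` N. C i) = topspace (subtopology ?T (F k))"
      unfolding top using F_new[of k] by (auto simp: C_def)
    show "disjoint_family_on C (idx ` N)"
      by (auto simp: C_def disjoint_family_on_def)
    fix i assume i: "i \<in> idx ` N"
    \<comment> \<open>By \<open>F_far\<close> a ball of this radius about a point of
      \<open>C i\<close> meets no other piece, so the pieces are open in \<open>F k\<close>.\<close>
    have "C i = (\<Union>u\<in>C i. amalgam.mball u (inverse (real (Suc k)))) \<inter> F k"
    proof (intro equalityI subsetI)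
      fix u assume "u \<in> C i"
      then show "u \<in> (\<Union>u\<in>C i. amalgam.mball u (inverse (real (Suc k)))) \<inter> F k"
        by (auto simp: C_def F_def intro!: bexI[of _ u])
    next
      fix v assume v: "v \<in> (\<Union>u\<in>C i. amalgam.mball u (inverse (real (Suc k)))) \<inter> F k"
      then obtain u where u: "u \<in> C i" "D u v < inverse (real (Suc k))"
        by auto
      then show "v \<in> C i"
        using F_far[of u k v] v by (fastforce simp: C_def)
    qed
    then show "openin (subtopology ?T (F k)) (C i)"
      unfolding openin_subtopology by (metis (no_types, lifting) amalgam.openin_mball openin_Union imageE)
    have Fi: "F k \<inter> Range (ext i) = C i"
    proof -
      have "u \<in> Range (ext i) \<longleftrightarrow> idx u = i" if "u \<in> F k" for u
      proof -
        have "u \<in> N"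
          using F_new that by blast
        moreover have "Range (R i) \<subseteq> M"
          using R_iso[of i] by (auto simp: partial_isometry_def)
        ultimately show ?thesis
          using disj by (auto simp: ext_def)
      qed
      then show ?thesis
        by (auto simp: C_def)
    qed
    have "R i \<noteq> {}"
      using i R_ne by auto
    then have "covering_dim_le (subtopology ?T (Range (ext i))) n"
      by (rule covering_dim_le_Range_ext[OF assms])
    then have "covering_dim_le (subtopology (subtopology ?T (Range (ext i))) (Range (ext i) \<inter> F k)) n"
      by (rule covering_dim_le_closed_subtopology) (rule closedin_subtopology_Int_closed[OF F_closed])
    moreover have "C i \<subseteq> Range (ext i)" "C i \<subseteq> F k"
      using Fi by auto
    ultimately show "covering_dim_le (subtopology (subtopology ?T (F k)) (C i)) n"
      using Fi by (simp add: subtopology_subtopology Int_commute inf.absorb1 inf.absorb2)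
  qed
  define G where "G k = (case k of 0 \<Rightarrow> M | Suc k \<Rightarrow> F k)" for k
  show ?thesis
  proof (rule covering_dim_le_countable_closed_sum)
    show "normal_space ?T"
      by (rule amalgam.normal_space_mtopology)
    show "closedin ?T (G k)" for k
      using closedin_old F_closed by (simp add: G_def split: nat.split)
    show "covering_dim_le (subtopology ?T (G k)) n" for k
      using assms F_dim subtopology_old by (simp add: G_def split: nat.split)
    show "(\<Union>k. G k) = topspace ?T"
    proof
      show "(\<Union>k. G k) \<subseteq> topspace ?T"
        by (auto simp: G_def F_def split: nat.splits)
      show "topspace ?T \<subseteq> (\<Union>k. G k)"
      proof
        fix u assume u: "u \<in> topspace ?T"
        show "u \<in> (\<Union>k. G k)"
        proof (cases "u \<in> M")
          case True
          then have "u \<in> G 0" by (simp add: G_def)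
          then show ?thesis by blast
        next
          case False
          then have uN: "u \<in> N"
            using u by simp
          obtain e where e: "e > 0" "\<forall>v\<in>M \<union> N. \<not> same_copy u v \<longrightarrow> e \<le> D u v"
            using D_new_bound[OF uN] by blast
          obtain k where "inverse (real (Suc k)) < e"
            using reals_Archimedean[OF e(1)] by auto
          moreover have "e \<le> D u z" if "z \<in> M" for z
            using e(2) not_same_copy_old[OF uN that] that by blast
          ultimately have "u \<in> F k"
            using uN unfolding F_def by fastforce
          then have "u \<in> G (Suc k)"
            by (simp add: G_def)
          then show ?thesis by blast
        qed
      qed
    qed
  qed
qed

end

subsection \<open>Cardinality\<close>

text \<open>The bridge to the order on cardinals, where the arithmetic of infinite cardinals is
  available.\<close>

lemma lepoll_iff_ordLeq: "A \<lesssim> B \<longleftrightarrow> ordLeq3 (card_of A) (card_of B)"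
  by (simp add: lepoll_def card_of_ordLeq[symmetric])

lemma UN_nat_lepoll_infinite:
  assumes "infinite A" "\<And>n::nat. B n \<lesssim> A"
  shows "(\<Union>n. B n) \<lesssim> A"
  using assms card_of_UNION_ordLeq_infinite[of A "UNIV :: nat set" B]
  by (simp add: lepoll_iff_ordLeq infinite_iff_card_of_nat)

lemma Un_lepoll_infinite:
  assumes "infinite A" "B \<lesssim> A" "C \<lesssim> A"
  shows "B \<union> C \<lesssim> A"
proof -
  have "B \<union> C = (\<Union>n::nat. if n = 0 then B else C)"
    by auto
  then show ?thesis
    using UN_nat_lepoll_infinite[OF assms(1), of "\<lambda>n. if n = 0 then B else C"] assms by simp
qed

lemma Times_lepoll_infinite:
  assumes "infinite A" "B \<lesssim> A" "C \<lesssim> A"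
  shows "B \<times> C \<lesssim> A"
  using times_lepoll_mono[OF assms(2,3)] card_of_Times_same_infinite[OF assms(1)]
  by (meson eqpoll_iff_card_of_ordIso eqpoll_imp_lepoll lepoll_trans)

lemma lists_lepoll_infinite:
  assumes "infinite A" "B \<lesssim> A"
  shows "lists B \<lesssim> A"
proof -
  have "{xs \<in> lists B. length xs = n} \<lesssim> A" for n
  proof (induction n)
    case 0
    have "{xs \<in> lists B. length xs = 0} = {[]}"
      by auto
    then show ?case
      using assms(1) by (simp add: finite_lepoll_infinite)
  next
    case (Suc n)
    have "{xs \<in> lists B. length xs = Suc n} \<subseteq> (\<lambda>(x, xs). x # xs) ` (B \<times> {xs \<in> lists B. length xs = n})"
    proof
      fix xs assume "xs \<in> {xs \<in> lists B. length xs = Suc n}"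
      then show "xs \<in> (\<lambda>(x, xs). x # xs) ` (B \<times> {xs \<in> lists B. length xs = n})"
        by (cases xs) auto
    qed
    then have "{xs \<in> lists B. length xs = Suc n} \<lesssim> B \<times> {xs \<in> lists B. length xs = n}"
      by (meson image_lepoll lepoll_trans subset_imp_lepoll)
    then show ?case
      using Times_lepoll_infinite[OF assms Suc] lepoll_trans by blast
  qed
  then have "(\<Union>n. {xs \<in> lists B. length xs = n}) \<lesssim> A"
    by (rule UN_nat_lepoll_infinite[OF assms(1)])
  moreover have "lists B = (\<Union>n. {xs \<in> lists B. length xs = n})"
    by auto
  ultimately show ?thesis
    by simp
qed

subsection \<open>Unions of chains of metric spaces\<close>

locale metric_chain =
  fixes P :: "nat \<Rightarrow> 'a set" and d :: "nat \<Rightarrow> 'a \<Rightarrow> 'a \<Rightarrow> real"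
  assumes metric: "\<And>n. Metric_space (P n) (d n)"
    and P_Suc: "\<And>n. P n \<subseteq> P (Suc n)"
    and d_Suc: "\<And>n u v. u \<in> P n \<Longrightarrow> v \<in> P n \<Longrightarrow> d (Suc n) u v = d n u v"
    and closedin_Suc: "\<And>n. closedin (Metric_space.mtopology (P (Suc n)) (d (Suc n))) (P n)"
begin

definition lim_set :: "'a set" where
  "lim_set = (\<Union>n. P n)"

definition lim_dist :: "'a \<Rightarrow> 'a \<Rightarrow> real" where
  "lim_dist u v = d (LEAST n. {u, v} \<subseteq> P n) u v"

lemma P_mono: "m \<le> n \<Longrightarrow> P m \<subseteq> P n"
  by (rule lift_Suc_mono_le[of P]) (rule P_Suc)

lemma d_mono:
  assumes "m \<le> n" "u \<in> P m" "v \<in> P m"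
  shows "d n u v = d m u v"
  using assms(1)
proof (induction rule: dec_induct)
  case (step k)
  then show ?case
    using d_Suc[of u k v] P_mono[of m k] assms by auto
qed simp

lemma lim_dist_eq:
  assumes "u \<in> P n" "v \<in> P n"
  shows "lim_dist u v = d n u v"
proof -
  let ?k = "LEAST n. {u, v} \<subseteq> P n"
  have "{u, v} \<subseteq> P ?k" "?k \<le> n"
    using assms LeastI[of "\<lambda>n. {u, v} \<subseteq> P n" n] Least_le[of "\<lambda>n. {u, v} \<subseteq> P n" n] by auto
  then show ?thesis
    using d_mono[of ?k n u v] by (simp add: lim_dist_def)
qed

lemma finite_subset_lim:
  assumes "finite F" "F \<subseteq> lim_set"
  shows "\<exists>n. F \<subseteq> P n"
  using assms
proof (induction F)
  case (insert x F)
  then obtain m n where "x \<in> P m" "F \<subseteq> P n"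
    by (auto simp: lim_set_def)
  then have "insert x F \<subseteq> P (max m n)"
    using P_mono[of m "max m n"] P_mono[of n "max m n"] by auto
  then show ?case by blast
qed simp

lemma lim_metric: "Metric_space lim_set lim_dist"
proof
  fix x y
  \<comment> \<open>Nonnegativity and symmetry of each stage distance hold on the whole type, so the
    unspecified stage that \<open>LEAST\<close> yields for a pair outside the union does no
    harm.\<close>
  show "0 \<le> lim_dist x y"
    unfolding lim_dist_def by (rule Metric_space.nonneg[OF metric])
  show "lim_dist x y = lim_dist y x"
    unfolding lim_dist_def insert_commute[of x y] by (rule Metric_space.commute[OF metric])
next
  fix x y assume "x \<in> lim_set" "y \<in> lim_set"
  then obtain n where "x \<in> P n" "y \<in> P n"
    using finite_subset_lim[of "{x, y}"] by auto
  then show "lim_dist x y = 0 \<longleftrightarrow> x = y"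
    using Metric_space.zero[OF metric, of x n y] lim_dist_eq[of x n y] by simp
next
  fix x y z assume "x \<in> lim_set" "y \<in> lim_set" "z \<in> lim_set"
  then obtain n where "x \<in> P n" "y \<in> P n" "z \<in> P n"
    using finite_subset_lim[of "{x, y, z}"] by auto
  then show "lim_dist x z \<le> lim_dist x y + lim_dist y z"
    using Metric_space.triangle[OF metric, of x n y z] lim_dist_eq[of _ n] by simp
qed

sublocale lim: Metric_space lim_set lim_dist
  by (rule lim_metric)

lemma P_subset_lim: "P n \<subseteq> lim_set"
  by (auto simp: lim_set_def)

lemma subtopology_P:
  assumes "m \<le> n"
  shows "subtopology (Metric_space.mtopology (P n) (d n)) (P m) = Metric_space.mtopology (P m) (d m)"
proof -
  interpret Metric_space "P n" "d n"
    by (rule metric)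
  show ?thesis
    using P_mono[OF assms] d_mono[OF assms] by (intro subtopology_eq_mtopology metric) auto
qed

lemma subtopology_lim: "subtopology lim.mtopology (P n) = Metric_space.mtopology (P n) (d n)"
  using P_subset_lim lim_dist_eq by (intro lim.subtopology_eq_mtopology metric) auto

lemma closedin_P:
  assumes "m \<le> n"
  shows "closedin (Metric_space.mtopology (P n) (d n)) (P m)"
  using assms
proof (induction rule: dec_induct)
  case base
  show ?case
    using closedin_topspace[of "Metric_space.mtopology (P m) (d m)"]
    by (simp add: Metric_space.topspace_mtopology[OF metric])
next
  case (step k)
  then have "closedin (subtopology (Metric_space.mtopology (P (Suc k)) (d (Suc k))) (P k)) (P m)"
    by (simp add: subtopology_P)
  then show ?case
    using closedin_trans_full closedin_Suc by blast
qed

text \<open>A point off \<open>P n\<close> lies in some later stage \<open>P m\<close>, which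
  contains \<open>P n\<close> as a closed set. The gap found there remains a gap in the union, since
  later stages change no distances.\<close>

lemma closedin_lim: "closedin lim.mtopology (P n)"
proof -
  have "separated_in lim_set lim_dist (P n)"
    unfolding separated_in_def
  proof
    fix w assume w: "w \<in> lim_set - P n"
    then obtain m where m: "w \<in> P m" "n \<le> m"
      unfolding lim_set_def using P_mono by (metis DiffD1 UN_E max.cobounded1 max.cobounded2 subsetD)
    have "separated_in (P m) (d m) (P n)"
      using Metric_space.closedin_iff_separated[OF metric] P_mono[OF m(2)] closedin_P[OF m(2)] by blast
    then obtain e where e: "e > 0" "\<forall>a\<in>P n. e \<le> d m w a"
      using w m(1) unfolding separated_in_def by blast
    moreover have "lim_dist w a = d m w a" if "a \<in> P n" for a
      using lim_dist_eq[OF m(1)] P_mono[OF m(2)] that by blast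
    ultimately show "\<exists>e>0. \<forall>a\<in>P n. e \<le> lim_dist w a"
      by (intro exI[of _ e]) simp
  qed
  then show ?thesis
    using lim.closedin_iff_separated P_subset_lim by blast
qed

lemma covering_dim_le_lim_iff:
  assumes "\<And>m. covering_dim_le (Metric_space.mtopology (P m) (d m)) n \<Longrightarrow>
    covering_dim_le (Metric_space.mtopology (P (Suc m)) (d (Suc m))) n"
  shows "covering_dim_le lim.mtopology n \<longleftrightarrow> covering_dim_le (Metric_space.mtopology (P 0) (d 0)) n"
proof
  assume "covering_dim_le lim.mtopology n"
  then show "covering_dim_le (Metric_space.mtopology (P 0) (d 0)) n"
    using covering_dim_le_closed_subtopology closedin_lim subtopology_lim by metis
next
  assume 0: "covering_dim_le (Metric_space.mtopology (P 0) (d 0)) n"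
  have "covering_dim_le (Metric_space.mtopology (P m) (d m)) n" for m
    by (induction m) (fact 0, rule assms)
  then show "covering_dim_le lim.mtopology n"
    using covering_dim_le_countable_closed_sum[where F = P, OF lim.normal_space_mtopology closedin_lim]
    by (simp add: subtopology_lim flip: lim_set_def)
qed

end

subsection \<open>The tower of amalgams\<close>

text \<open>One recursive type holds all stages, so that they form an increasing chain of sets and
  their limit is a plain union. The number in \<open>New\<close> is the stage at which the point is
  added; it keeps new points apart from earlier ones.\<close>

datatype 'a point = Base 'a
  | New nat (new_idx: "('a point \<times> 'a point) list \<times> nat") (new_base: "'a point")

text \<open>For an empty relation the infimum in \<open>K\<close> would range over the empty set,
  hence the condition on \<open>R i\<close>.\<close>

definition new_points ::
  "nat \<Rightarrow> 'a point set \<Rightarrow> (('a point \<times> 'a point) list \<times> nat \<Rightarrow> ('a point \<times> 'a point) set) \<Rightarrow> 'a point set"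
  where "new_points n M R = {New n i x |i x. R i \<noteq> {} \<and> x \<in> M - Domain (R i)}"

text \<open>An unsuitable list yields the empty relation, so every list may serve as an
  index.\<close>

definition list_rel ::
  "'a set \<Rightarrow> ('a \<Rightarrow> 'a \<Rightarrow> real) \<Rightarrow> ('a \<times> 'a) list \<Rightarrow> ('a \<times> 'a) set"
  where "list_rel M d L = (if partial_isometry M d (set L) then set L else {})"

text \<open>\<open>Metric_space\<close> demands nonnegativity and symmetry on the whole type; the
  default 0 provides them off the base points.\<close>

definition base_dist :: "'a metric \<Rightarrow> 'a point \<Rightarrow> 'a point \<Rightarrow> real" where
  "base_dist X u v = (case (u, v) of (Base x, Base y) \<Rightarrow> mdist X x y | _ \<Rightarrow> 0)"

text \<open>The relation with index \<open>(L, 0)\<close> is the finite partial isometry listed by \<open>L\<close>, and the one with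
  index \<open>(L, m + 1)\<close> is the converse of the extension to the next stage of the one with index
  \<open>(L, m)\<close>; the converse makes the construction extend domain and range alternately.\<close>

primrec stage :: "'a metric \<Rightarrow> nat \<Rightarrow>
    'a point set \<times> ('a point \<Rightarrow> 'a point \<Rightarrow> real) \<times>
    (('a point \<times> 'a point) list \<times> nat \<Rightarrow> ('a point \<times> 'a point) set)" where
  "stage X 0 =
     (let M = Base ` mspace X; d = base_dist X
      in (M, d, \<lambda>(L, m). if m = 0 then list_rel M d L else {}))"
| "stage X (Suc n) =
     (let (M, d, R) = stage X n; N = new_points n M R; M' = M \<union> N;
        d' = star_amalgam.D M d N new_idx new_base R
      in (M', d', \<lambda>(L, m). case m of 0 \<Rightarrow> list_rel M' d' L
           | Suc k \<Rightarrow> (star_amalgam.ext N new_idx new_base R (L, k))\<inverse>))"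

definition stage_set where "stage_set X n = fst (stage X n)"
definition stage_dist where "stage_dist X n = fst (snd (stage X n))"
definition stage_rel where "stage_rel X n = snd (snd (stage X n))"
definition stage_new where "stage_new X n = new_points n (stage_set X n) (stage_rel X n)"

lemma stage_simps:
  "stage_set X 0 = Base ` mspace X"
  "stage_dist X 0 = base_dist X"
  "stage_rel X 0 (L, m) = (if m = 0 then list_rel (stage_set X 0) (stage_dist X 0) L else {})"
  "stage_set X (Suc n) = stage_set X n \<union> stage_new X n"
  "stage_dist X (Suc n) =
     star_amalgam.D (stage_set X n) (stage_dist X n) (stage_new X n) new_idx new_base (stage_rel X n)"
  "stage_rel X (Suc n) (L, 0) = list_rel (stage_set X (Suc n)) (stage_dist X (Suc n)) L"
  "stage_rel X (Suc n) (L, Suc m) =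
     (star_amalgam.ext (stage_new X n) new_idx new_base (stage_rel X n) (L, m))\<inverse>"
  by (simp_all add: stage_set_def stage_dist_def stage_rel_def stage_new_def Let_def split: prod.split)

lemma list_rel_props:
  assumes "Metric_space M d"
  shows "partial_isometry M d (list_rel M d L)" "separated_in M d (Domain (list_rel M d L))"
    "separated_in M d (Range (list_rel M d L))"
proof -
  show iso: "partial_isometry M d (list_rel M d L)"
    by (simp add: list_rel_def partial_isometry_def)
  then have sub: "list_rel M d L \<subseteq> M \<times> M" and "finite (list_rel M d L)"
    unfolding partial_isometry_def by (blast, simp add: list_rel_def)
  then have "finite (Domain (list_rel M d L))" "finite (Range (list_rel M d L))"
    by (auto intro: finite_Domain finite_Range)
  moreover have "Domain (list_rel M d L) \<subseteq> M" "Range (list_rel M d L) \<subseteq> M"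
    using sub by auto
  ultimately show "separated_in M d (Domain (list_rel M d L))" "separated_in M d (Range (list_rel M d L))"
    using Metric_space.finite_separated[OF assms] by simp_all
qed

lemma Metric_space_base_dist: "Metric_space (Base ` mspace X) (base_dist X)"
proof
  fix u v w assume "u \<in> Base ` mspace X" "v \<in> Base ` mspace X" "w \<in> Base ` mspace X"
  then show "base_dist X u w \<le> base_dist X u v + base_dist X v w"
    by (auto simp: base_dist_def mdist_triangle)
qed (auto simp: base_dist_def mdist_commute split: point.split)

lemma star_amalgam_stage_aux:
  assumes "Metric_space (stage_set X n) (stage_dist X n)"
    "\<And>k i x. New k i x \<in> stage_set X n \<Longrightarrow> k < n"
    "\<And>i. partial_isometry (stage_set X n) (stage_dist X n) (stage_rel X n i) \<and>
      separated_in (stage_set X n) (stage_dist X n) (Domain (stage_rel X n i)) \<and>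
      separated_in (stage_set X n) (stage_dist X n) (Range (stage_rel X n i))"
  shows "star_amalgam (stage_set X n) (stage_dist X n) (stage_new X n) new_idx new_base (stage_rel X n)"
proof -
  interpret Metric_space "stage_set X n" "stage_dist X n" by fact
  show ?thesis
  proof
    show "stage_new X n \<inter> stage_set X n = {}"
      using assms(2) by (fastforce simp: stage_new_def new_points_def)
    fix i x assume "stage_rel X n i \<noteq> {}" "x \<in> stage_set X n - Domain (stage_rel X n i)"
    then have "New n i x \<in> stage_new X n"
      unfolding stage_new_def new_points_def by blast
    then show "\<exists>u\<in>stage_new X n. new_idx u = i \<and> new_base u = x"
      by (rule bexI[rotated]) simp
  qed (use assms(3) in \<open>auto simp: stage_new_def new_points_def\<close>)
qed

text \<open>The bound \<open>k < n\<close> makes the points \<open>New n i x\<close> fresh.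
  Closedness of both ends of the relations is inherited: the converse of a nonempty extension has
  the closed image of the old stage as domain and the old stage itself as range.\<close>

lemma stage_invariant:
  "Metric_space (stage_set X n) (stage_dist X n) \<and>
   (\<forall>k i x. New k i x \<in> stage_set X n \<longrightarrow> k < n) \<and>
   (\<forall>i. partial_isometry (stage_set X n) (stage_dist X n) (stage_rel X n i) \<and>
      separated_in (stage_set X n) (stage_dist X n) (Domain (stage_rel X n i)) \<and>
      separated_in (stage_set X n) (stage_dist X n) (Range (stage_rel X n i)))"
proof (induction n)
  case 0
  have M: "Metric_space (stage_set X 0) (stage_dist X 0)"
    by (simp add: stage_simps Metric_space_base_dist)
  have "partial_isometry M d {}" "separated_in M d {}" for M :: "'a point set" and d
    by (auto simp: partial_isometry_def separated_in_def intro: exI[of _ 1])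
  then show ?case
    using M list_rel_props[OF M] stage_simps(1,3)[of X] by auto
next
  case (Suc n)
  interpret star_amalgam "stage_set X n" "stage_dist X n" "stage_new X n" new_idx new_base "stage_rel X n"
    using Suc by (intro star_amalgam_stage_aux) auto
  have eq: "stage_set X (Suc n) = stage_set X n \<union> stage_new X n" "stage_dist X (Suc n) = D"
    by (simp_all add: stage_simps)
  have M: "Metric_space (stage_set X (Suc n)) (stage_dist X (Suc n))"
    unfolding eq by (rule amalgam.Metric_space_axioms)
  have "k < Suc n" if "New k i x \<in> stage_set X (Suc n)" for k i x
  proof -
    have "New k i x \<in> stage_set X n \<or> k = n"
      using that unfolding eq stage_new_def new_points_def by blast
    then show ?thesis
      using Suc less_SucI by blast
  qed
  moreover have "partial_isometry (stage_set X (Suc n)) (stage_dist X (Suc n)) (stage_rel X (Suc n) (L, m)) \<and>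
      separated_in (stage_set X (Suc n)) (stage_dist X (Suc n)) (Domain (stage_rel X (Suc n) (L, m))) \<and>
      separated_in (stage_set X (Suc n)) (stage_dist X (Suc n)) (Range (stage_rel X (Suc n) (L, m)))" for L m
  proof (cases m)
    case 0
    then show ?thesis
      using list_rel_props[OF M] by (simp add: stage_simps(6))
  next
    case (Suc k)
    have "separated_in (stage_set X n \<union> stage_new X n) D (Domain (ext (L, k)))"
    proof (cases "stage_rel X n (L, k) = {}")
      case True
      then have "ext (L, k) = {}"
        by (rule ext_empty)
      then show ?thesis
        by (auto simp: separated_in_def intro: exI[of _ 1])
    next
      case False
      then show ?thesis
        using Domain_ext old_separated by simp
    qed
    moreover have "stage_rel X (Suc n) (L, m) = (ext (L, k))\<inverse>"
      by (simp add: stage_simps(7) Suc)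
    ultimately show ?thesis
      using partial_isometry_converse[OF ext_partial_isometry] Range_ext_separated
      unfolding eq by (metis Domain_converse Range_converse)
  qed
  ultimately show ?case
    using M by (metis surj_pair)
qed

lemma star_amalgam_stage:
  "star_amalgam (stage_set X n) (stage_dist X n) (stage_new X n) new_idx new_base (stage_rel X n)"
  using stage_invariant[of X n] by (intro star_amalgam_stage_aux) auto

lemma metric_chain_stage: "metric_chain (stage_set X) (stage_dist X)"
proof (rule metric_chain.intro)
  fix n
  show "Metric_space (stage_set X n) (stage_dist X n)"
    using stage_invariant by blast
  interpret star_amalgam "stage_set X n" "stage_dist X n" "stage_new X n" new_idx new_base "stage_rel X n"
    by (rule star_amalgam_stage)
  show "stage_set X n \<subseteq> stage_set X (Suc n)"
    by (auto simp: stage_simps)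
  show "stage_dist X (Suc n) u v = stage_dist X n u v" if "u \<in> stage_set X n" "v \<in> stage_set X n" for u v
    using D_old[OF that] by (simp add: stage_simps)
  show "closedin (Metric_space.mtopology (stage_set X (Suc n)) (stage_dist X (Suc n))) (stage_set X n)"
    using closedin_old by (simp add: stage_simps)
qed

lemma covering_dim_le_stage_Suc:
  assumes "covering_dim_le (Metric_space.mtopology (stage_set X m) (stage_dist X m)) n"
  shows "covering_dim_le (Metric_space.mtopology (stage_set X (Suc m)) (stage_dist X (Suc m))) n"
proof -
  interpret star_amalgam "stage_set X m" "stage_dist X m" "stage_new X m" new_idx new_base "stage_rel X m"
    by (rule star_amalgam_stage)
  show ?thesis
    using covering_dim_le_amalgam[OF assms] by (simp add: stage_simps)
qed

text \<open>This bounds the number of copies: of all lists over the type, only those over the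
  current stage can have a nonempty relation and so produce points.\<close>

lemma stage_rel_index: "stage_rel X n (L, m) \<noteq> {} \<Longrightarrow> L \<in> lists (stage_set X n \<times> stage_set X n)"
proof (induction n arbitrary: m)
  case 0
  then show ?case
    by (auto simp: stage_simps(3) list_rel_def partial_isometry_def split: if_splits)
next
  case (Suc n)
  interpret star_amalgam "stage_set X n" "stage_dist X n" "stage_new X n" new_idx new_base "stage_rel X n"
    by (rule star_amalgam_stage)
  show ?case
  proof (cases m)
    case 0
    then show ?thesis
      using Suc.prems by (auto simp: stage_simps(6) list_rel_def partial_isometry_def split: if_splits)
  next
    case (Suc k)
    then have "stage_rel X n (L, k) \<noteq> {}"
      using Suc.prems ext_empty[of "(L, k)"] by (auto simp: stage_simps(7))
    from Suc.IH[OF this] show ?thesis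
      by (auto simp: stage_simps(4))
  qed
qed

text \<open>\<open>A\<close> is any infinite set, not \<open>mspace X\<close>, to include a finite
  \<open>X\<close>, whose later stages may be infinite.\<close>

lemma stage_set_lepoll:
  assumes "infinite A" "mspace X \<lesssim> A"
  shows "stage_set X n \<lesssim> A"
proof (induction n)
  case 0
  show ?case
    unfolding stage_simps using assms(2) image_lepoll lepoll_trans by blast
next
  case (Suc n)
  let ?M = "stage_set X n"
  let ?f = "\<lambda>(i, x). New n i x"
  have "stage_new X n \<subseteq> ?f ` ((lists (?M \<times> ?M) \<times> UNIV) \<times> ?M)"
    using stage_rel_index by (fastforce simp: stage_new_def new_points_def)
  then have "stage_new X n \<lesssim> (lists (?M \<times> ?M) \<times> (UNIV :: nat set)) \<times> ?M"
    by (meson image_lepoll lepoll_trans subset_imp_lepoll)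
  also have "\<dots> \<lesssim> A"
    using assms(1) Suc by (intro Times_lepoll_infinite lists_lepoll_infinite)
      (auto simp: infinite_le_lepoll[symmetric])
  finally have "stage_new X n \<lesssim> A" .
  then show ?case
    using Un_lepoll_infinite[OF assms(1) Suc] by (simp add: stage_simps(4))
qed

section \<open>The back-and-forth in the union of the stages\<close>

lemma stage_rel_Suc_alternates:
  "stage_rel X n (L, m) \<subseteq> (stage_rel X (Suc n) (L, Suc m))\<inverse>"
proof -
  interpret star_amalgam "stage_set X n" "stage_dist X n" "stage_new X n" new_idx new_base "stage_rel X n"
    by (rule star_amalgam_stage)
  show ?thesis
    by (simp add: stage_simps(7) ext_def)
qed

lemma Range_stage_rel_Suc:
  assumes "stage_rel X n (L, m) \<noteq> {}"
  shows "Range (stage_rel X (Suc n) (L, Suc m)) = stage_set X n"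
proof -
  interpret star_amalgam "stage_set X n" "stage_dist X n" "stage_new X n" new_idx new_base "stage_rel X n"
    by (rule star_amalgam_stage)
  show ?thesis
    using Domain_ext[OF assms] by (simp add: stage_simps(7))
qed

context
  fixes X :: "'a metric"
begin

interpretation metric_chain "stage_set X" "stage_dist X"
  by (rule metric_chain_stage)

lemma stage_limit_extension:
  assumes R: "finite R" "R \<noteq> {}" "partial_isometry lim_set lim_dist R"
  shows "\<exists>G. R \<subseteq> G \<and> partial_isometry lim_set lim_dist G \<and> Domain G = lim_set \<and> Range G = lim_set"
proof -
  obtain L where L: "set L = R"
    using finite_list[OF R(1)] by blast
  have "finite (Domain R \<union> Range R)" "Domain R \<union> Range R \<subseteq> lim_set"
    using R by (auto simp: partial_isometry_def intro: finite_Domain finite_Range)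
  then obtain n where n: "Domain R \<union> Range R \<subseteq> stage_set X n"
    using finite_subset_lim by blast
  have sub: "R \<subseteq> stage_set X n \<times> stage_set X n"
    using n by auto
  have "stage_dist X n (fst p) (fst q) = stage_dist X n (snd p) (snd q)" if "p \<in> R" "q \<in> R" for p q
  proof -
    have "fst p \<in> stage_set X n" "snd p \<in> stage_set X n" "fst q \<in> stage_set X n" "snd q \<in> stage_set X n"
      using sub that by auto
    then show ?thesis
      using R(3) that lim_dist_eq unfolding partial_isometry_def by metis
  qed
  then have "partial_isometry (stage_set X n) (stage_dist X n) (set L)"
    using sub L by (simp add: partial_isometry_def)
  then have E0: "stage_rel X n (L, 0) = R"
    by (cases n) (simp_all add: stage_simps(3,6) list_rel_def L)
  \<comment> \<open>\<open>E\<close> follows the isometry named by \<open>L\<close> through the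
    stages. The step from \<open>E m\<close> to \<open>E (Suc m)\<close> enlarges the domain to the
    whole stage \<open>n + m\<close> and then reverses the direction.\<close>
  define E where "E m = stage_rel X (n + m) (L, m)" for m
  have E_Suc: "E m \<subseteq> (E (Suc m))\<inverse>" for m
    using stage_rel_Suc_alternates[of X "n + m" L m] by (simp add: E_def)
  have E_ne: "E m \<noteq> {}" for m
  proof (induction m)
    case 0
    then show ?case
      using E0 R(2) by (simp add: E_def)
  next
    case (Suc m)
    then show ?case
      using E_Suc[of m] by auto
  qed
  have E_ran: "Range (E (Suc m)) = stage_set X (n + m)" for m
    using Range_stage_rel_Suc[of X "n + m" L m] E_ne[of m] by (simp add: E_def)
  have E_dom: "stage_set X (n + m) \<subseteq> Domain (E (Suc (Suc m)))" for m
    using E_ran[of m] E_Suc[of "Suc m"] by blast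
  have E_iso: "partial_isometry (stage_set X (n + m)) (stage_dist X (n + m)) (E m)" for m
    using stage_invariant[of X "n + m"] by (simp add: E_def)
  \<comment> \<open>Two steps restore the direction, so the even members form an increasing chain
    that starts with \<open>R\<close>. The domain of \<open>H (Suc k)\<close> contains stage
    \<open>n + 2 * k\<close>, its range is stage \<open>n + Suc (2 * k)\<close>; hence the union is
    onto on both sides.\<close>
  define H where "H k = E (2 * k)" for k
  have "H k \<subseteq> H (Suc k)" for k
    using E_Suc[of "2 * k"] E_Suc[of "Suc (2 * k)"] by (auto simp: H_def)
  then have H_mono: "H k \<subseteq> H l" if "k \<le> l" for k l
    using lift_Suc_mono_le[of H] that by blast
  have H_iso: "partial_isometry lim_set lim_dist (H k)" for k
    unfolding partial_isometry_def
  proof (intro conjI ballI)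
    have sub: "H k \<subseteq> stage_set X (n + 2 * k) \<times> stage_set X (n + 2 * k)"
      using E_iso[of "2 * k"] by (simp add: H_def partial_isometry_def)
    then show "H k \<subseteq> lim_set \<times> lim_set"
      using P_subset_lim by blast
    fix p q assume pq: "p \<in> H k" "q \<in> H k"
    then have "stage_dist X (n + 2 * k) (fst p) (fst q) = stage_dist X (n + 2 * k) (snd p) (snd q)"
      using E_iso[of "2 * k"] by (simp add: H_def partial_isometry_def)
    moreover have "fst p \<in> stage_set X (n + 2 * k)" "snd p \<in> stage_set X (n + 2 * k)"
      "fst q \<in> stage_set X (n + 2 * k)" "snd q \<in> stage_set X (n + 2 * k)"
      using sub pq by auto
    ultimately show "lim_dist (fst p) (fst q) = lim_dist (snd p) (snd q)"
      using lim_dist_eq by simp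
  qed
  have H_dom: "stage_set X k \<subseteq> Domain (H (Suc k))" for k
    using E_dom[of "2 * k"] P_mono[of k "n + 2 * k"] by (auto simp: H_def)
  have H_ran: "stage_set X k \<subseteq> Range (H (Suc k))" for k
    using E_ran[of "Suc (2 * k)"] P_mono[of k "n + Suc (2 * k)"] by (auto simp: H_def)
  have "partial_isometry lim_set lim_dist (\<Union>k. H k)"
    unfolding partial_isometry_def
  proof (intro conjI ballI)
    show "(\<Union>k. H k) \<subseteq> lim_set \<times> lim_set"
      using H_iso unfolding partial_isometry_def by blast
    fix p q assume "p \<in> (\<Union>k. H k)" "q \<in> (\<Union>k. H k)"
    then obtain k l where "p \<in> H k" "q \<in> H l"
      by blast
    then have "p \<in> H (max k l)" "q \<in> H (max k l)"
      using H_mono[of k "max k l"] H_mono[of l "max k l"] by auto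
    then show "lim_dist (fst p) (fst q) = lim_dist (snd p) (snd q)"
      using H_iso[of "max k l"] unfolding partial_isometry_def by blast
  qed
  moreover have "Domain (\<Union>k. H k) = lim_set" "Range (\<Union>k. H k) = lim_set"
  proof -
    have eq: "Domain (\<Union>k. H k) = (\<Union>k. Domain (H k))" "Range (\<Union>k. H k) = (\<Union>k. Range (H k))"
      by auto
    have sub: "Domain (H k) \<subseteq> lim_set" "Range (H k) \<subseteq> lim_set" for k
      using H_iso[of k] by (auto simp: partial_isometry_def)
    show "Domain (\<Union>k. H k) = lim_set"
      unfolding eq
    proof (intro equalityI UN_least sub)
      show "lim_set \<subseteq> (\<Union>k. Domain (H k))"
        unfolding lim_set_def by (intro UN_least order.trans[OF H_dom] UN_upper) simp
    qed
    show "Range (\<Union>k. H k) = lim_set"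
      unfolding eq
    proof (intro equalityI UN_least sub)
      show "lim_set \<subseteq> (\<Union>k. Range (H k))"
        unfolding lim_set_def by (intro UN_least order.trans[OF H_ran] UN_upper) simp
    qed
  qed
  moreover have "R \<subseteq> (\<Union>k. H k)"
  proof -
    have "R = H 0"
      by (simp add: H_def E_def E0)
    then show ?thesis by blast
  qed
  ultimately show ?thesis
    by blast
qed

lemma stage_limit_ultrahomogeneous: "metrically_ultrahomogeneous (metric (lim_set, lim_dist))"
  unfolding metrically_ultrahomogeneous_def
proof (intro allI impI)
  fix A B f
  let ?Z = "metric (lim_set, lim_dist)"
  assume asm: "A \<subseteq> mspace ?Z \<and> finite A \<and> B \<subseteq> mspace ?Z \<and> finite B \<and>
    isometry_onto (submetric ?Z A) (submetric ?Z B) f"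
  then have AB: "A \<subseteq> lim_set" "B \<subseteq> lim_set" "finite A"
    by auto
  then have f: "f x \<in> B" "\<And>y. y \<in> A \<Longrightarrow> lim_dist (f x) (f y) = lim_dist x y" if "x \<in> A" for x
    using asm that by (auto simp: isometry_onto_def isometric_embedding_def inf.absorb1)
  show "\<exists>g. isometry_onto ?Z ?Z g \<and> (\<forall>x\<in>A. g x = f x)"
  \<comment> \<open>No copy is attached along the empty isometry; the identity extends it.\<close>
  proof (cases "A = {}")
    case True
    then show ?thesis
      by (intro exI[of _ id]) (simp add: isometry_onto_def isometric_embedding_def)
  next
    case False
    define R where "R = (\<lambda>x. (x, f x)) ` A"
    have "partial_isometry lim_set lim_dist R"
      using f AB by (auto simp: R_def partial_isometry_def)
    then obtain G where G: "R \<subseteq> G" "partial_isometry lim_set lim_dist G"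
      "Domain G = lim_set" "Range G = lim_set"
      using stage_limit_extension[of R] AB(3) False by (auto simp: R_def)
    have iso: "lim_dist x x' = lim_dist y y'" if "(x, y) \<in> G" "(x', y') \<in> G" for x y x' y'
      using G(2) that unfolding partial_isometry_def by fastforce
    have G_in: "x \<in> lim_set" "y \<in> lim_set" if "(x, y) \<in> G" for x y
      using that G(3,4) by auto
    define g where "g x = (SOME y. (x, y) \<in> G)" for x
    have g: "(x, g x) \<in> G" if "x \<in> lim_set" for x
      using that unfolding g_def G(3)[symmetric] by (auto intro: someI)
    have g_eq: "g x = y" if "(x, y) \<in> G" for x y
    proof -
      have "lim_dist (g x) y = lim_dist x x"
        using iso[OF g[OF G_in(1)[OF that]] that] by simp
      then show ?thesis
        using G_in[OF that] G_in(2)[OF g] by simp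
    qed
    have "isometry_onto ?Z ?Z g"
      unfolding isometry_onto_def isometric_embedding_def lim.mspace_metric lim.mdist_metric
    proof (intro conjI ballI)
      show "g \<in> lim_set \<rightarrow> lim_set"
        using G_in(2) g by blast
      show "lim_dist (g x) (g y) = lim_dist x y" if "x \<in> lim_set" "y \<in> lim_set" for x y
        using iso[OF g[OF that(1)] g[OF that(2)]] by simp
      show "g ` lim_set = lim_set"
      proof
        show "g ` lim_set \<subseteq> lim_set"
          using G_in(2) g by blast
        show "lim_set \<subseteq> g ` lim_set"
        proof
          fix y assume "y \<in> lim_set"
          then obtain x where "(x, y) \<in> G"
            using G(4) by blast
          then show "y \<in> g ` lim_set"
            using g_eq G_in(1) by blast
        qed
      qed
    qed
    moreover have "g x = f x" if "x \<in> A" for x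
      using G(1) that by (intro g_eq) (auto simp: R_def)
    ultimately show ?thesis
      by blast
  qed
qed

lemma mtopology_stage_0:
  "mtopology_of X homeomorphic_space Metric_space.mtopology (stage_set X 0) (stage_dist X 0)"
proof -
  interpret Metric_space12 "mspace X" "mdist X" "stage_set X 0" "stage_dist X 0"
    by (simp add: Metric_space12_def metric)
  have "homeomorphic_map M1.mtopology M2.mtopology Base"
    by (rule isometry_imp_homeomorphic_map) (auto simp: stage_simps base_dist_def)
  then show ?thesis
    unfolding mtopology_of_def by (rule homeomorphic_map_imp_homeomorphic_space)
qed

text \<open>Dimension is passed on as an equivalence of all bounds; the value -1 is fixed separately
  in \<open>covering_dim\<close>, which is where the last clause enters. \<open>A\<close> is left
  open so that a finite \<open>X\<close> can be compared with a countable set.\<close>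

lemma ultrahomogeneous_point_extension:
  obtains Z :: "'a point metric" where "closed_isometric_embedding X Z Base"
    "metrically_ultrahomogeneous Z"
    "\<And>n. covering_dim_le (mtopology_of Z) n \<longleftrightarrow> covering_dim_le (mtopology_of X) n"
    "\<And>A :: 'b set. infinite A \<Longrightarrow> mspace X \<lesssim> A \<Longrightarrow> mspace Z \<lesssim> A"
    "mspace X = {} \<Longrightarrow> mspace Z = {}"
proof
  let ?Z = "metric (lim_set, lim_dist)"
  show "closed_isometric_embedding X ?Z Base"
    unfolding closed_isometric_embedding_def isometric_embedding_def
  proof (intro conjI ballI)
    have mem: "Base x \<in> stage_set X 0" if "x \<in> mspace X" for x
      using that by (simp add: stage_simps)
    then show "Base \<in> mspace X \<rightarrow> mspace ?Z"
      using P_subset_lim by auto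
    show "mdist ?Z (Base x) (Base y) = mdist X x y" if "x \<in> mspace X" "y \<in> mspace X" for x y
      using lim_dist_eq[OF mem[OF that(1)] mem[OF that(2)]] by (simp add: stage_simps base_dist_def)
    show "closedin (mtopology_of ?Z) (Base ` mspace X)"
      using closedin_lim[of 0] by (simp add: stage_simps)
  qed
  show "metrically_ultrahomogeneous ?Z"
    by (rule stage_limit_ultrahomogeneous)
  show "covering_dim_le (mtopology_of ?Z) n \<longleftrightarrow> covering_dim_le (mtopology_of X) n" for n
    using covering_dim_le_lim_iff[OF covering_dim_le_stage_Suc] mtopology_stage_0
      homeomorphic_covering_dim_le homeomorphic_space_sym by (metis lim.mtopology_of)
  show "mspace ?Z \<lesssim> A" if "infinite A" "mspace X \<lesssim> A" for A :: "'b set"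
    using UN_nat_lepoll_infinite[where B = "stage_set X", OF that(1) stage_set_lepoll[OF that]]
    by (simp flip: lim_set_def)
  show "mspace ?Z = {}" if "mspace X = {}"
  proof -
    have "stage_set X n = {}" for n
    proof (induction n)
      case 0
      show ?case
        using that by (simp add: stage_simps)
    next
      case (Suc n)
      then show ?case
        by (simp add: stage_simps stage_new_def new_points_def)
    qed
    then show ?thesis
      unfolding lim.mspace_metric by (simp add: lim_set_def)
  qed
qed

end

subsection \<open>Transport to the given type\<close>

lemma isometric_embedding_inj_on:
  assumes "isometric_embedding X Z f"
  shows "inj_on f (mspace X)"
proof (rule inj_onI)
  fix x y assume xy: "x \<in> mspace X" "y \<in> mspace X" and "f x = f y"
  have "mdist Z (f x) (f y) = mdist X x y" "f y \<in> mspace Z"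
    using assms xy by (auto simp: isometric_embedding_def)
  then show "x = y"
    using \<open>f x = f y\<close> xy Metric_space.zero[OF Metric_space_mspace_mdist, of x X y]
      Metric_space.zero[OF Metric_space_mspace_mdist, of "f y" Z "f y"] by simp
qed

text \<open>Conjugation by \<open>j\<close> moves a finite partial isometry of \<open>W\<close> to
  \<open>Z\<close> and brings its extension back.\<close>

lemma isometry_onto_ultrahomogeneous:
  assumes j: "isometry_onto Z W j" and Z: "metrically_ultrahomogeneous Z"
  shows "metrically_ultrahomogeneous W"
  unfolding metrically_ultrahomogeneous_def
proof (intro allI impI)
  fix A B f
  assume asm: "A \<subseteq> mspace W \<and> finite A \<and> B \<subseteq> mspace W \<and> finite B \<and>
    isometry_onto (submetric W A) (submetric W B) f"
  define k where "k = inv_into (mspace Z) j"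
  have jd: "mdist W (j x) (j y) = mdist Z x y" if "x \<in> mspace Z" "y \<in> mspace Z" for x y
    using j that by (simp add: isometry_onto_def isometric_embedding_def)
  have im: "j ` mspace Z = mspace W"
    using j by (simp add: isometry_onto_def)
  have k: "k w \<in> mspace Z" "j (k w) = w" if "w \<in> mspace W" for w
    using that unfolding k_def im[symmetric] by (auto intro: inv_into_into f_inv_into_f)
  have kd: "mdist Z (k v) (k w) = mdist W v w" if "v \<in> mspace W" "w \<in> mspace W" for v w
    using jd[of "k v" "k w"] k that by simp
  have "inj_on j (mspace Z)"
    using j isometric_embedding_inj_on unfolding isometry_onto_def by blast
  then have kj: "k (j x) = x" if "x \<in> mspace Z" for x
    using that by (simp add: k_def)
  have sub: "A \<subseteq> mspace W" "B \<subseteq> mspace W"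
    using asm by auto
  have fd: "mdist W (f v) (f w) = mdist W v w" if "v \<in> A" "w \<in> A" for v w
    using asm that sub by (simp add: isometry_onto_def isometric_embedding_def inf.absorb1)
  have fim: "f ` A = B"
    using asm sub by (simp add: isometry_onto_def inf.absorb1)
  have kA: "k ` A \<subseteq> mspace Z" "k ` B \<subseteq> mspace Z"
    using k(1) sub by auto
  have fW: "f v \<in> mspace W" if "v \<in> A" for v
    using fim sub(2) that by blast
  have "isometry_onto (submetric Z (k ` A)) (submetric Z (k ` B)) (k \<circ> f \<circ> j)"
    unfolding isometry_onto_def isometric_embedding_def mspace_submetric mdist_submetric
      inf.absorb1[OF kA(1)] inf.absorb1[OF kA(2)]
  proof (intro conjI ballI)
    have "(k \<circ> f \<circ> j) (k v) = k (f v)" if "v \<in> A" for v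
      using k(2) sub(1) that by auto
    then show im': "(k \<circ> f \<circ> j) ` k ` A = k ` B"
      unfolding fim[symmetric] image_image by (simp cong: image_cong)
    then show "k \<circ> f \<circ> j \<in> k ` A \<rightarrow> k ` B"
      by blast
    fix x y assume "x \<in> k ` A" "y \<in> k ` A"
    then obtain v w where "v \<in> A" "x = k v" "w \<in> A" "y = k w"
      by blast
    then show "mdist Z ((k \<circ> f \<circ> j) x) ((k \<circ> f \<circ> j) y) = mdist Z x y"
      using k(2) sub(1) kd fW fd by (simp add: subset_iff)
  qed
  moreover have "finite (k ` A)" "finite (k ` B)"
    using asm by auto
  ultimately obtain g where g: "isometry_onto Z Z g" "\<forall>x\<in>k ` A. g x = (k \<circ> f \<circ> j) x"
    using Z[unfolded metrically_ultrahomogeneous_def, rule_format, of "k ` A" "k ` B" "k \<circ> f \<circ> j"] kA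
    by auto
  have gZ: "g x \<in> mspace Z" if "x \<in> mspace Z" for x
    using g(1) that by (auto simp: isometry_onto_def isometric_embedding_def)
  have "isometry_onto W W (j \<circ> g \<circ> k)"
    unfolding isometry_onto_def isometric_embedding_def
  proof (intro conjI ballI)
    have "k ` mspace W = mspace Z"
      using kj k(1) im by force
    then show "(j \<circ> g \<circ> k) ` mspace W = mspace W"
      using g(1) im by (simp only: image_comp[symmetric] isometry_onto_def)
    then show "j \<circ> g \<circ> k \<in> mspace W \<rightarrow> mspace W"
      by blast
    fix v w assume "v \<in> mspace W" "w \<in> mspace W"
    then show "mdist W ((j \<circ> g \<circ> k) v) ((j \<circ> g \<circ> k) w) = mdist W v w"
      using g(1) jd gZ k(1) kd by (simp add: isometry_onto_def isometric_embedding_def)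
  qed
  moreover have "(j \<circ> g \<circ> k) v = f v" if "v \<in> A" for v
    using g(2) that k(2) sub(1) fW by (auto simp: subset_iff)
  ultimately show "\<exists>g. isometry_onto W W g \<and> (\<forall>x\<in>A. g x = f x)"
    by blast
qed

lemma isometry_onto_homeomorphic_map:
  assumes "isometry_onto Z W j"
  shows "homeomorphic_map (mtopology_of Z) (mtopology_of W) j"
proof -
  interpret Metric_space12 "mspace Z" "mdist Z" "mspace W" "mdist W"
    by (rule Metric_space12_mspace_mdist)
  show ?thesis
    unfolding mtopology_of_def using assms
    by (intro isometry_imp_homeomorphic_map) (auto simp: isometry_onto_def isometric_embedding_def)
qed

lemma isometry_onto_transport:
  assumes "inj_on j (mspace Z)"
  obtains W where "isometry_onto Z W j" "mspace W = j ` mspace Z"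
proof -
  define k where "k = inv_into (mspace Z) j"
  have k: "k (j x) = x" if "x \<in> mspace Z" for x
    using assms that by (simp add: k_def)
  have "Metric_space (j ` mspace Z) (\<lambda>u v. mdist Z (k u) (k v))"
    using k by unfold_locales (auto simp: mdist_commute dest: inj_onD[OF assms] intro: mdist_triangle)
  then interpret W: Metric_space "j ` mspace Z" "\<lambda>u v. mdist Z (k u) (k v)" .
  show thesis
  proof
    show "isometry_onto Z (metric (j ` mspace Z, \<lambda>u v. mdist Z (k u) (k v))) j"
      by (simp add: isometry_onto_def isometric_embedding_def k)
  qed simp
qed

lemma covering_dim_cong:
  assumes "topspace S = {} \<longleftrightarrow> topspace T = {}" "\<And>n. covering_dim_le S n \<longleftrightarrow> covering_dim_le T n"
  shows "covering_dim S = covering_dim T"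
  using assms by (simp add: covering_dim_def)

theorem theorem5p18:
  fixes X :: "'a metric"
  shows "\<exists>(Z :: ('a + nat) metric) f.
           closed_isometric_embedding X Z f \<and>
           metrically_ultrahomogeneous Z \<and>
           covering_dim (mtopology_of Z) = covering_dim (mtopology_of X) \<and>
           (if finite (mspace X) then countable (mspace Z) else mspace Z \<approx> mspace X)"
proof -
  obtain Y :: "'a point metric" where Y: "closed_isometric_embedding X Y Base"
      "metrically_ultrahomogeneous Y"
    and dim: "\<And>n. covering_dim_le (mtopology_of Y) n \<longleftrightarrow> covering_dim_le (mtopology_of X) n"
    and card: "\<And>A :: ('a + nat) set. infinite A \<Longrightarrow> mspace X \<lesssim> A \<Longrightarrow> mspace Y \<lesssim> A"
    and empty: "mspace X = {} \<Longrightarrow> mspace Y = {}"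
    using ultrahomogeneous_point_extension[where X = X] by blast
  \<comment> \<open>For finite \<open>X\<close> the space \<open>Y\<close> may be infinite, and
    \<open>Inr\<close> supplies a countable set for it. For infinite \<open>X\<close> the set
    \<open>S\<close> has the size of \<open>X\<close>, so \<open>mspace Z\<close> lies between two
    sets of that size.\<close>
  define S :: "('a + nat) set" where "S = (if finite (mspace X) then range Inr else Inl ` mspace X)"
  have "infinite S"
    by (auto simp: S_def finite_image_iff inj_on_def)
  moreover have "mspace X \<lesssim> S"
  proof (cases "finite (mspace X)")
    case True
    then show ?thesis
      using \<open>infinite S\<close> by (simp add: finite_lepoll_infinite)
  next
    case False
    then show ?thesis
      by (auto simp: S_def lepoll_def inj_on_def intro!: exI[of _ Inl])
  qed
  ultimately have "mspace Y \<lesssim> S"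
    by (rule card)
  then obtain j where j: "inj_on j (mspace Y)" "j ` mspace Y \<subseteq> S"
    by (auto simp: lepoll_def)
  obtain Z where Z: "isometry_onto Y Z j" "mspace Z = j ` mspace Y"
    using isometry_onto_transport[OF j(1)] by blast
  have hom: "homeomorphic_map (mtopology_of Y) (mtopology_of Z) j"
    using Z(1) by (rule isometry_onto_homeomorphic_map)
  have emb: "closed_isometric_embedding X Z (j \<circ> Base)"
    unfolding closed_isometric_embedding_def
  proof
    show "isometric_embedding X Z (j \<circ> Base)"
      using Y(1) Z(1) unfolding closed_isometric_embedding_def isometric_embedding_def isometry_onto_def
      by (auto simp: Pi_iff)
    have "closedin (mtopology_of Y) (Base ` mspace X)"
      using Y(1) by (simp add: closed_isometric_embedding_def)
    then show "closedin (mtopology_of Z) ((j \<circ> Base) ` mspace X)"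
      using homeomorphic_map_closedness[OF hom] closedin_subset by (metis image_comp)
  qed
  have Z_sub: "mspace Z \<subseteq> S"
    using Z(2) j(2) by simp
  have XZ: "mspace X \<lesssim> mspace Z"
    using emb isometric_embedding_inj_on[of X Z "j \<circ> Base"]
    unfolding closed_isometric_embedding_def isometric_embedding_def lepoll_def by blast
  have "mspace Z \<approx> mspace X" if "infinite (mspace X)"
  proof -
    have "S \<lesssim> mspace X"
      using that by (simp add: S_def image_lepoll)
    then show ?thesis
      using XZ Z_sub lepoll_antisym lepoll_trans subset_imp_lepoll by metis
  qed
  moreover have "countable (mspace Z)" if "finite (mspace X)"
    using Z_sub that countable_subset[of "mspace Z" S] by (simp add: S_def)
  moreover have "covering_dim (mtopology_of Z) = covering_dim (mtopology_of X)"
  proof (rule covering_dim_cong)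
    show "topspace (mtopology_of Z) = {} \<longleftrightarrow> topspace (mtopology_of X) = {}"
      using empty Z(2) XZ by auto
    have YZ: "mtopology_of Y homeomorphic_space mtopology_of Z"
      using hom by (rule homeomorphic_map_imp_homeomorphic_space)
    then have "mtopology_of Z homeomorphic_space mtopology_of Y"
      by (rule homeomorphic_space_sym[THEN iffD1])
    then show "covering_dim_le (mtopology_of Z) n \<longleftrightarrow> covering_dim_le (mtopology_of X) n" for n
      unfolding dim[symmetric] using YZ by (intro iffI) (erule homeomorphic_covering_dim_le, assumption)+
  qed
  ultimately show ?thesis
    using emb isometry_onto_ultrahomogeneous[OF Z(1) Y(2)]
    by (intro exI[of _ Z] exI[of _ "j \<circ> Base"]) simp
qed

end
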